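(* Let $\mathbb{F}$ be a field of characteristic not equal to $2$. Suppose $(A,X)$ is a $2$-generated primitive $\mathcal{M}(\alpha,\beta)$-axial algebra over $\mathbb{F}$ and the axet $\langle X\rangle$ is isomorphic to $X'(1+2)$. Then either 1. $A\cong 3\mathrm{C}(\alpha,1-\alpha)$ with $\alpha\neq\frac12$ and $\alpha+\beta=1$; or 2. $(\alpha,\beta)=(\frac13,\frac23)$ and either (i) $A\cong Q_2(\frac13,\frac23)$ if $\mathbb{F}$ has characteristic not equal to $5$, or (ii) $A\cong Q_2(\frac13)^\times\oplus\langle \mathbf{1}\rangle$ if $\mathbb{F}$ has characteristic equal to $5$.
   Context: Algebras are commutative but not necessarily associative. For $a\in A$ let $\mathrm{ad}_a:x\mapsto ax$ and, for $\lambda\in\mathbb{F}$, let $A_\lambda(a)=\{x\in A: ax=\lambda x\}$; for $S\subseteq\mathbb{F}$ put $A_S(a)=\bigoplus_{\lambda\in S}A_\lambda(a)$ (so $A_\emptyset(a)=0$). A (symmetric) fusion law is a set $\mathcal{F}\subseteq\mathbb{F}$ with a symmetric map $\star:\mathcal{F}\times\mathcal{F}\to 2^{\mathcal{F}}$. For $\alpha,\beta\in\mathbb{F}\setminus\{0,1\}$ distinct, $\mathcal{M}(\alpha,\beta)$ is the fusion law on $\{0,1,\alpha,\beta\}$ with $1\star1=\{1\}$, $0\star0=\{0\}$, $1\star0=\emptyset$, $1\star\alpha=0\star\alpha=\{\alpha\}$, $1\star\beta=0\star\beta=\{\beta\}$, $\alpha\star\alpha=\{1,0\}$, $\alpha\star\beta=\{\beta\}$,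 $\beta\star\beta=\{1,0,\alpha\}$. A (primitive) $\mathcal{F}$-axis is an element $a\in A$ with $a^2=a$, $A=A_{\mathcal{F}}(a)$, $A_\lambda(a)A_\mu(a)\subseteq A_{\lambda\star\mu}(a)$ for all $\lambda,\mu\in\mathcal{F}$, and $A_1(a)=\mathbb{F}a$. A primitive $\mathcal{F}$-axial algebra is a pair $(A,X)$ where $X$ is a set of primitive $\mathcal{F}$-axes generating $A$ as an algebra; $2$-generated means $|X|=2$. Miyamoto involution: for an $\mathcal{M}(\alpha,\beta)$-axis $a$, $\tau_a:A\to A$ is the linear map acting as the identity on $A_{\{0,1,\alpha\}}(a)$ and as $-1$ on $A_\beta(a)$; it is an automorphism of $A$. The closure $\langle X\rangle$ is the smallest set of axes containing $X$ which is invariant under $\tau_x$ for every $x$ in it. The axet $X'(1+2)$ has exactly three elements $a,b,c$, where $\tau_a$ fixes $a$ and swaps $b$ and $c$, and $\tau_b,\tau_c$ fix each of $a,b,c$. Thus $\langle X\rangle\cong X'(1+2)$ means that $\langle X\rangle$ consists of exactly three axes which can be labelled $a,b,c$ so that their Miyamoto involutions permute them in this way. The algebras ($\cong$ denotes isomorphism of algebras; the second parameters record the fusion law under consideration): - $3\mathrm{C}(\eta)$, $\eta\notin\{0,1\}$: basis $x,y,z$, all idempotent, with $xy=\frac{\eta}{2}(x+y-z)$, $xz=\frac{\eta}{2}(x+z-y)$, $yz=\frac{\eta}{2}(y+z-x)$. For $\alpha\notin\{0,1,\frac12,-1\}$, $3\mathrm{C}(\alpha,1-\alpha)$ is $3\mathrm{C}(\alpha)$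 regarded with fusion law $\mathcal{M}(\alpha,1-\alpha)$ (generated by the axes $\mathbf{1}-x$ and $y$, where $\mathbf{1}=\frac{1}{\alpha+1}(x+y+z)$ is the identity). For $\alpha=-1$, $3\mathrm{C}(-1,2)$ is the algebra $3\mathrm{C}(2)$ regarded with fusion law $\mathcal{M}(-1,2)$. - $Q_2(\frac13)$ (characteristic not $2,3$): basis $s_1,s_2,d_1,d_2$, all idempotent, with $s_1s_2=0$, and for $i=1,2$: $s_id_1=\frac13s_i+\frac16d_1-\frac16d_2$, $s_id_2=\frac13s_i-\frac16d_1+\frac16d_2$; and $d_1d_2=-\frac13s_1-\frac13s_2+\frac13d_1+\frac13d_2$. In characteristic not $5$ it has identity $\mathbf{1}=\frac35(s_1+s_2+d_1+d_2)$, and $Q_2(\frac13,\frac23)$ denotes this algebra regarded with fusion law $\mathcal{M}(\frac13,\frac23)$ (generated by the axes $s_1$ and $\mathbf{1}-d_1$). - $Q_2(\frac13)^\times\oplus\langle\mathbf{1}\rangle$ (characteristic $5$): basis $x,y,z,\mathbf{1}$ with $\mathbf{1}$ an identity element, $x,y,z$ idempotent, $xy=0$, $xz=3x+y+2z$, $yz=x+3y+2z$. *)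

theory Defs
  imports "HOL-Analysis.Cartesian_Space"
begin

section \<open>Fusion laws\<close>

definition fusion_law :: "'f set \<Rightarrow> ('f \<Rightarrow> 'f \<Rightarrow> 'f set) \<Rightarrow> bool" where
  "fusion_law F star \<longleftrightarrow>
     (\<forall>l\<in>F. \<forall>m\<in>F. star l m \<subseteq> F \<and> star l m = star m l)"

definition monster_set :: "'f::field \<Rightarrow> 'f \<Rightarrow> 'f set" where
  "monster_set \<alpha> \<beta> = {0, 1, \<alpha>, \<beta>}"

text \<open>The arguments are compared as unordered pairs, which builds in the symmetry;
  \<open>{l, m} = {1}\<close> says that both arguments are \<open>1\<close>.  The values outside
  \<open>monster_set \<alpha> \<beta>\<close> are irrelevant.\<close>

definition monster_star :: "'f::field \<Rightarrow> 'f \<Rightarrow> 'f \<Rightarrow> 'f \<Rightarrow> 'f set" where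
  "monster_star \<alpha> \<beta> l m =
    (if {l, m} = {1} then {1}
     else if {l, m} = {0} then {0}
     else if {l, m} = {1, 0} then {}
     else if {l, m} = {1, \<alpha>} \<or> {l, m} = {0, \<alpha>} then {\<alpha>}
     else if {l, m} = {1, \<beta>} \<or> {l, m} = {0, \<beta>} then {\<beta>}
     else if {l, m} = {\<alpha>} then {1, 0}
     else if {l, m} = {\<alpha>, \<beta>} then {\<beta>}
     else if {l, m} = {\<beta>} then {1, 0, \<alpha>}
     else {})"

lemma fusion_law_monster: "fusion_law (monster_set \<alpha> \<beta>) (monster_star \<alpha> \<beta>)"
proof -
  have "monster_star \<alpha> \<beta> l m \<subseteq> monster_set \<alpha> \<beta>" for l m
    unfolding monster_set_def monster_star_def by auto
  moreover have "monster_star \<alpha> \<beta> l m = monster_star \<alpha> \<beta> m l" for l m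
    unfolding monster_star_def insert_commute[of l m "{}"] by (rule refl)
  ultimately show ?thesis unfolding fusion_law_def by blast
qed

lemma monster_star_simps:
  fixes \<alpha> \<beta> :: "'f::field"
  assumes "\<alpha> \<noteq> 0" "\<alpha> \<noteq> 1" "\<beta> \<noteq> 0" "\<beta> \<noteq> 1" "\<alpha> \<noteq> \<beta>"
  shows "monster_star \<alpha> \<beta> 1 1 = {1}"
    and "monster_star \<alpha> \<beta> 0 0 = {0}"
    and "monster_star \<alpha> \<beta> 1 0 = {}"
    and "monster_star \<alpha> \<beta> 1 \<alpha> = {\<alpha>}"
    and "monster_star \<alpha> \<beta> 0 \<alpha> = {\<alpha>}"
    and "monster_star \<alpha> \<beta> 1 \<beta> = {\<beta>}"
    and "monster_star \<alpha> \<beta> 0 \<beta> = {\<beta>}"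
    and "monster_star \<alpha> \<beta> \<alpha> \<alpha> = {1, 0}"
    and "monster_star \<alpha> \<beta> \<alpha> \<beta> = {\<beta>}"
    and "monster_star \<alpha> \<beta> \<beta> \<beta> = {1, 0, \<alpha>}"
  using assms unfolding monster_star_def by (simp_all add: doubleton_eq_iff)


section \<open>Commutative algebras and axes\<close>

text \<open>The algebra is the whole type \<open>'a\<close>.  Distributivity and homogeneity are
  assumed on one side only; the other side follows by commutativity.\<close>

locale comm_algebra = vector_space sc
  for sc :: "'f::field \<Rightarrow> 'a::ab_group_add \<Rightarrow> 'a" +
  fixes mult :: "'a \<Rightarrow> 'a \<Rightarrow> 'a"
  assumes mult_commute: "mult x y = mult y x"
    and mult_add_right: "mult x (y + z) = mult x y + mult x z"
    and mult_scale_right: "mult x (sc c y) = sc c (mult x y)"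
begin

definition eigenspace :: "'a \<Rightarrow> 'f \<Rightarrow> 'a set" where
  "eigenspace a l = {x. mult a x = sc l x}"

text \<open>The sum of the eigenspaces for the eigenvalues in \<open>S\<close>; it is automatically direct,
  since eigenspaces for distinct eigenvalues are independent.\<close>

definition eigensum :: "'a \<Rightarrow> 'f set \<Rightarrow> 'a set" where
  "eigensum a S = span (\<Union>l\<in>S. eigenspace a l)"

definition primitive_axis :: "'f set \<Rightarrow> ('f \<Rightarrow> 'f \<Rightarrow> 'f set) \<Rightarrow> 'a \<Rightarrow> bool" where
  "primitive_axis F star a \<longleftrightarrow>
     mult a a = a \<and>
     eigensum a F = UNIV \<and>
     (\<forall>l\<in>F. \<forall>m\<in>F. \<forall>x\<in>eigenspace a l. \<forall>y\<in>eigenspace a m.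
        mult x y \<in> eigensum a (star l m)) \<and>
     eigenspace a 1 = range (\<lambda>c. sc c a)"

definition subalgebra :: "'a set \<Rightarrow> bool" where
  "subalgebra B \<longleftrightarrow> subspace B \<and> (\<forall>x\<in>B. \<forall>y\<in>B. mult x y \<in> B)"

definition primitive_axial_algebra :: "'f set \<Rightarrow> ('f \<Rightarrow> 'f \<Rightarrow> 'f set) \<Rightarrow> 'a set \<Rightarrow> bool" where
  "primitive_axial_algebra F star X \<longleftrightarrow>
     fusion_law F star \<and> (\<forall>a\<in>X. primitive_axis F star a) \<and> subalgebra hull X = UNIV"

abbreviation monster_axis :: "'f \<Rightarrow> 'f \<Rightarrow> 'a \<Rightarrow> bool" where
  "monster_axis \<alpha> \<beta> \<equiv> primitive_axis (monster_set \<alpha> \<beta>) (monster_star \<alpha> \<beta>)"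

text \<open>For an axis \<open>a\<close> the algebra is the sum of the two subspaces below, so there is
  exactly one such linear map.\<close>

definition miyamoto :: "'f \<Rightarrow> 'f \<Rightarrow> 'a \<Rightarrow> 'a \<Rightarrow> 'a" where
  "miyamoto \<alpha> \<beta> a = (THE t. Vector_Spaces.linear sc sc t \<and>
     (\<forall>x\<in>eigensum a {0, 1, \<alpha>}. t x = x) \<and> (\<forall>x\<in>eigenspace a \<beta>. t x = - x))"

definition axis_closure :: "'f \<Rightarrow> 'f \<Rightarrow> 'a set \<Rightarrow> 'a set" where
  "axis_closure \<alpha> \<beta> X =
     (\<lambda>Y. (\<forall>x\<in>Y. monster_axis \<alpha> \<beta> x) \<and> (\<forall>x\<in>Y. miyamoto \<alpha> \<beta> x ` Y \<subseteq> Y)) hull X"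

text \<open>The set \<open>Y\<close> of axes is isomorphic to the axet \<open>X'(1+2)\<close>.\<close>

definition axet_X1p2 :: "'f \<Rightarrow> 'f \<Rightarrow> 'a set \<Rightarrow> bool" where
  "axet_X1p2 \<alpha> \<beta> Y \<longleftrightarrow> (\<exists>a b c. distinct [a, b, c] \<and> Y = {a, b, c} \<and>
     miyamoto \<alpha> \<beta> a a = a \<and> miyamoto \<alpha> \<beta> a b = c \<and> miyamoto \<alpha> \<beta> a c = b \<and>
     (\<forall>y\<in>{a, b, c}. miyamoto \<alpha> \<beta> b y = y \<and> miyamoto \<alpha> \<beta> c y = y))"

end

definition algebra_iso ::
  "('f::field \<Rightarrow> 'a::ab_group_add \<Rightarrow> 'a) \<Rightarrow> ('a \<Rightarrow> 'a \<Rightarrow> 'a) \<Rightarrow>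
   ('f \<Rightarrow> 'b::ab_group_add \<Rightarrow> 'b) \<Rightarrow> ('b \<Rightarrow> 'b \<Rightarrow> 'b) \<Rightarrow> bool" where
  "algebra_iso sc mult sc' mult' \<longleftrightarrow>
     (\<exists>f. Vector_Spaces.linear sc sc' f \<and> bij f \<and>
          (\<forall>x y. f (mult x y) = mult' (f x) (f y)))"


section \<open>The algebras of the classification\<close>

text \<open>The algebra on \<open>'f ^ 'i\<close> in which the product of the standard basis vectors with
  indices \<open>i\<close> and \<open>j\<close> is \<open>T i j\<close>.\<close>

definition table_mult :: "('i::finite \<Rightarrow> 'i \<Rightarrow> 'f::field ^ 'i) \<Rightarrow> 'f ^ 'i \<Rightarrow> 'f ^ 'i \<Rightarrow> 'f ^ 'i" where
  "table_mult T u v = (\<Sum>i\<in>UNIV. \<Sum>j\<in>UNIV. (u $ i * v $ j) *s T i j)"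

abbreviation bvec :: "'i::finite \<Rightarrow> 'f::field ^ 'i" where
  "bvec i \<equiv> axis i 1"

lemma table_mult_bvec: "table_mult T (bvec i) (bvec j) = T i j"
proof -
  have "(bvec i $ k * bvec j $ l) *s T k l =
      (if l = j then (if k = i then T k l else 0) else 0)" for k l
    by (auto simp: axis_def)
  then show ?thesis unfolding table_mult_def by (simp add: sum.delta)
qed

lemma comm_algebra_table_mult:
  fixes T :: "'i::finite \<Rightarrow> 'i \<Rightarrow> 'f::field ^ 'i"
  assumes "\<And>i j. T i j = T j i"
  shows "comm_algebra (*s) (table_mult T)"
proof unfold_locales
  fix x y z :: "'f ^ 'i" and c :: 'f
  have "table_mult T x y = (\<Sum>j\<in>UNIV. \<Sum>i\<in>UNIV. (x $ i * y $ j) *s T i j)"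
    unfolding table_mult_def by (rule sum.swap)
  also have "\<dots> = table_mult T y x"
    unfolding table_mult_def by (simp add: mult.commute assms)
  finally show "table_mult T x y = table_mult T y x" .
  show "table_mult T x (y + z) = table_mult T x y + table_mult T x z"
    unfolding table_mult_def
    by (simp add: distrib_left vec.scale_left_distrib sum.distrib)
  show "table_mult T x (c *s y) = c *s table_mult T x y"
    unfolding table_mult_def
    by (simp add: vec.scale_sum_right vec.scale_scale mult.left_commute)
qed

text \<open>The algebra \<open>3C(\<eta>)\<close>.\<close>

datatype idx3C = Bx | By | Bz

instance idx3C :: finite
proof
  have "UNIV = {Bx, By, Bz}" using idx3C.exhaust by auto
  then show "finite (UNIV :: idx3C set)" by (metis finite.emptyI finite.insertI)
qed

fun table_3C :: "'f::field \<Rightarrow> idx3C \<Rightarrow> idx3C \<Rightarrow> 'f ^ idx3C" where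
  "table_3C \<eta> Bx Bx = bvec Bx"
| "table_3C \<eta> By By = bvec By"
| "table_3C \<eta> Bz Bz = bvec Bz"
| "table_3C \<eta> Bx By = (\<eta> / 2) *s (bvec Bx + bvec By - bvec Bz)"
| "table_3C \<eta> By Bx = (\<eta> / 2) *s (bvec Bx + bvec By - bvec Bz)"
| "table_3C \<eta> Bx Bz = (\<eta> / 2) *s (bvec Bx + bvec Bz - bvec By)"
| "table_3C \<eta> Bz Bx = (\<eta> / 2) *s (bvec Bx + bvec Bz - bvec By)"
| "table_3C \<eta> By Bz = (\<eta> / 2) *s (bvec By + bvec Bz - bvec Bx)"
| "table_3C \<eta> Bz By = (\<eta> / 2) *s (bvec By + bvec Bz - bvec Bx)"

definition mult_3C :: "'f::field \<Rightarrow> 'f ^ idx3C \<Rightarrow> 'f ^ idx3C \<Rightarrow> 'f ^ idx3C" where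
  "mult_3C \<eta> = table_mult (table_3C \<eta>)"

text \<open>The underlying algebra of \<open>3C(\<alpha>, 1 - \<alpha>)\<close>.  It is \<open>3C(\<alpha>)\<close>, except that
  \<open>3C(-1)\<close> has no identity and \<open>3C(-1, 2)\<close> is by convention the algebra \<open>3C(2)\<close>.\<close>

definition mult_3C2 :: "'f::field \<Rightarrow> 'f ^ idx3C \<Rightarrow> 'f ^ idx3C \<Rightarrow> 'f ^ idx3C" where
  "mult_3C2 \<alpha> = (if \<alpha> = - 1 then mult_3C 2 else mult_3C \<alpha>)"

text \<open>The algebra \<open>Q\<^sub>2(1/3)\<close>, which is only meaningful if the characteristic is neither
  2 nor 3.\<close>

datatype idxQ2 = S1 | S2 | D1 | D2

instance idxQ2 :: finite
proof
  have "UNIV = {S1, S2, D1, D2}" using idxQ2.exhaust by auto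
  then show "finite (UNIV :: idxQ2 set)" by (metis finite.emptyI finite.insertI)
qed

fun table_Q2 :: "idxQ2 \<Rightarrow> idxQ2 \<Rightarrow> 'f::field ^ idxQ2" where
  "table_Q2 S1 S1 = bvec S1"
| "table_Q2 S2 S2 = bvec S2"
| "table_Q2 D1 D1 = bvec D1"
| "table_Q2 D2 D2 = bvec D2"
| "table_Q2 S1 S2 = 0"
| "table_Q2 S2 S1 = 0"
| "table_Q2 S1 D1 = (1/3) *s bvec S1 + (1/6) *s bvec D1 - (1/6) *s bvec D2"
| "table_Q2 D1 S1 = (1/3) *s bvec S1 + (1/6) *s bvec D1 - (1/6) *s bvec D2"
| "table_Q2 S2 D1 = (1/3) *s bvec S2 + (1/6) *s bvec D1 - (1/6) *s bvec D2"
| "table_Q2 D1 S2 = (1/3) *s bvec S2 + (1/6) *s bvec D1 - (1/6) *s bvec D2"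
| "table_Q2 S1 D2 = (1/3) *s bvec S1 - (1/6) *s bvec D1 + (1/6) *s bvec D2"
| "table_Q2 D2 S1 = (1/3) *s bvec S1 - (1/6) *s bvec D1 + (1/6) *s bvec D2"
| "table_Q2 S2 D2 = (1/3) *s bvec S2 - (1/6) *s bvec D1 + (1/6) *s bvec D2"
| "table_Q2 D2 S2 = (1/3) *s bvec S2 - (1/6) *s bvec D1 + (1/6) *s bvec D2"
| "table_Q2 D1 D2 = - (1/3) *s bvec S1 - (1/3) *s bvec S2 + (1/3) *s bvec D1 + (1/3) *s bvec D2"
| "table_Q2 D2 D1 = - (1/3) *s bvec S1 - (1/3) *s bvec S2 + (1/3) *s bvec D1 + (1/3) *s bvec D2"

definition mult_Q2 :: "'f::field ^ idxQ2 \<Rightarrow> 'f ^ idxQ2 \<Rightarrow> 'f ^ idxQ2" where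
  "mult_Q2 = table_mult table_Q2"

text \<open>The algebra \<open>Q\<^sub>2(1/3)\<^sup>\<times> \<oplus> \<langle>1\<rangle>\<close> in characteristic 5; \<open>E1\<close> is the index of the
  identity element.\<close>

datatype idxQ2x = Ex | Ey | Ez | E1

instance idxQ2x :: finite
proof
  have "UNIV = {Ex, Ey, Ez, E1}" using idxQ2x.exhaust by auto
  then show "finite (UNIV :: idxQ2x set)" by (metis finite.emptyI finite.insertI)
qed

fun table_Q2x :: "idxQ2x \<Rightarrow> idxQ2x \<Rightarrow> 'f::field ^ idxQ2x" where
  "table_Q2x E1 i = bvec i"
| "table_Q2x i E1 = bvec i"
| "table_Q2x Ex Ex = bvec Ex"
| "table_Q2x Ey Ey = bvec Ey"
| "table_Q2x Ez Ez = bvec Ez"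
| "table_Q2x Ex Ey = 0"
| "table_Q2x Ey Ex = 0"
| "table_Q2x Ex Ez = 3 *s bvec Ex + bvec Ey + 2 *s bvec Ez"
| "table_Q2x Ez Ex = 3 *s bvec Ex + bvec Ey + 2 *s bvec Ez"
| "table_Q2x Ey Ez = bvec Ex + 3 *s bvec Ey + 2 *s bvec Ez"
| "table_Q2x Ez Ey = bvec Ex + 3 *s bvec Ey + 2 *s bvec Ez"

definition mult_Q2x :: "'f::field ^ idxQ2x \<Rightarrow> 'f ^ idxQ2x \<Rightarrow> 'f ^ idxQ2x" where
  "mult_Q2x = table_mult table_Q2x"

lemma comm_algebra_mult_3C2: "comm_algebra (*s) (mult_3C2 \<alpha>)"
proof -
  have "table_3C \<eta> i j = table_3C \<eta> j i" for \<eta> :: 'a and i j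
    by (cases i; cases j) simp_all
  then show ?thesis unfolding mult_3C2_def mult_3C_def by (simp add: comm_algebra_table_mult)
qed

lemma comm_algebra_mult_Q2: "comm_algebra (*s) mult_Q2"
  unfolding mult_Q2_def
proof (rule comm_algebra_table_mult)
  show "table_Q2 i j = table_Q2 j i" for i j by (cases i; cases j) simp_all
qed

lemma comm_algebra_mult_Q2x: "comm_algebra (*s) mult_Q2x"
  unfolding mult_Q2x_def
proof (rule comm_algebra_table_mult)
  show "table_Q2x i j = table_Q2x j i" for i j by (cases i; cases j) simp_all
qed

end

theory Submission
  imports Defs
begin

text \<open>The generating pair consists of \<open>a\<close> and one of \<open>b\<close>, \<open>c\<close>, say \<open>b\<close>.  Since \<open>\<tau>\<^sub>b\<close>
  fixes \<open>a\<close> and \<open>b\<close>, it is trivial, so \<open>b\<close> has no \<open>\<beta>\<close>-part.  Put \<open>p = b + c\<close>, which is fixed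
  by \<open>\<tau>\<^sub>a\<close>, and \<open>e = b - c\<close>, which is negated.  Splitting relations such as \<open>b(ab) = \<alpha> ab + \<dots>\<close>
  into their \<open>\<tau>\<^sub>a\<close>-even and odd parts gives the products of \<open>p\<close>, \<open>e\<close>, \<open>q = ap\<close> and \<open>f = e\<^sup>2\<close>;
  rewriting these in terms of \<open>b\<close>-eigenvectors and comparing components with the fusion law of \<open>b\<close>
  shows that the \<open>\<alpha>\<close>-part of \<open>e\<close> is a multiple \<open>k\<close> of the \<open>\<alpha>\<close>-part of \<open>a\<close>.
  If \<open>k \<noteq> 0\<close>, then \<open>q\<close> is a combination of \<open>a\<close> and \<open>p\<close>, which leaves a three-dimensional algebra
  with \<open>\<alpha> + \<beta> = 1\<close>.  If \<open>k = 0\<close>, then \<open>bc = 0\<close> and the remaining scalar equations force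
  \<open>\<alpha> = 1/3\<close> and \<open>\<beta> = 2/3\<close>.\<close>

lemma two_neq_zero_of_CHAR:
  assumes "CHAR('f::field) \<noteq> 2"
  shows "(2::'f) \<noteq> 0"
proof
  assume "(2::'f) = 0"
  then have "of_nat 2 = (0::'f)" by simp
  then have "CHAR('f) dvd 2" by (simp only: of_nat_eq_0_iff_char_dvd)
  then have "CHAR('f) \<le> 2" "CHAR('f) \<noteq> 0"
    by (simp add: dvd_imp_le, metis dvd_0_left_iff zero_neq_numeral)
  then show False using assms CHAR_not_1' by (metis One_nat_def le_Suc_eq le_zero_eq numeral_2_eq_2)
qed

section \<open>Bilinearity, linear functionals and independence of eigenspaces\<close>

context comm_algebra
begin

lemma mult_swap: "mult x y = z \<Longrightarrow> mult y x = z"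
  by (simp add: mult_commute)

lemma mult_add_left: "mult (x + y) z = mult x z + mult y z"
  by (metis mult_commute mult_add_right)

lemma mult_scale_left: "mult (sc c x) y = sc c (mult x y)"
  by (metis mult_commute mult_scale_right)

lemma mult_zero_right [simp]: "mult x 0 = 0"
  using mult_scale_right[of x 0 0] by simp

lemma mult_zero_left [simp]: "mult 0 x = 0"
  using mult_zero_right mult_commute by metis

lemma mult_minus_right: "mult x (- y) = - mult x y"
  using mult_scale_right[of x "-1" y] by simp

lemma mult_minus_left: "mult (- x) y = - mult x y"
  by (metis mult_minus_right mult_commute)

lemma mult_diff_right: "mult x (y - z) = mult x y - mult x z"
  using mult_add_right[of x y "- z"] mult_minus_right by simp

lemma mult_diff_left: "mult (x - y) z = mult x z - mult y z"
  by (metis mult_diff_right mult_commute)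

lemmas bilinear = mult_add_left mult_add_right mult_diff_left mult_diff_right
  mult_minus_left mult_minus_right mult_scale_left mult_scale_right

text \<open>Linear functionals separate points: a nonzero \<open>x - y\<close> is independent, so
  some functional takes the value 1 on it. Vector identities thereby become field identities, which
  the method \<open>algebra\<close> can derive from given relations.\<close>

lemma vec_eqI:
  assumes "\<And>l. Vector_Spaces.linear sc (*) l \<Longrightarrow> l x = l y"
  shows "x = y"
proof (rule ccontr)
  assume "x \<noteq> y"
  interpret F: vector_space "(*) :: 'f \<Rightarrow> 'f \<Rightarrow> 'f"
    by unfold_locales (simp_all add: algebra_simps)
  interpret vector_space_pair sc "(*) :: 'f \<Rightarrow> 'f \<Rightarrow> 'f"
    by unfold_locales
  have "independent {x - y}" using \<open>x \<noteq> y\<close> by (simp add: dependent_single)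
  from linear_independent_extend[OF this, of "\<lambda>_. 1"] obtain l
    where l: "Vector_Spaces.linear sc (*) l" "l (x - y) = 1" by auto
  interpret l: Vector_Spaces.linear sc "(*)" l by (rule l)
  show False using assms[OF l(1)] l(2) l.diff by simp
qed

text \<open>Instantiated with a functional \<open>l\<close>, these rules turn a linear relation between vectors
  into a polynomial relation in the field.\<close>

lemma functional_simps:
  assumes "Vector_Spaces.linear sc (*) l"
  shows "l (x + y) = l x + l y" "l (x - y) = l x - l y" "l (- x) = - l x"
    "l (sc c x) = c * l x" "l 0 = 0"
proof -
  interpret l: Vector_Spaces.linear sc "(*)" l by (rule assms)
  show "l (x + y) = l x + l y" "l (x - y) = l x - l y" "l (- x) = - l x"
    "l (sc c x) = c * l x" "l 0 = 0"
    by (simp_all add: l.add l.diff l.neg l.scale)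
qed

lemma subspace_eigenspace: "subspace (eigenspace a l)"
  by (auto simp: eigenspace_def subspace_def bilinear scale_right_distrib scale_left_commute)

lemma mem_eigenspace: "x \<in> eigenspace a l \<longleftrightarrow> mult a x = sc l x"
  by (simp add: eigenspace_def)

lemma subspace_eigensum: "subspace (eigensum a S)"
  by (simp add: eigensum_def)

lemma eigenspace_subset_eigensum: "l \<in> S \<Longrightarrow> eigenspace a l \<subseteq> eigensum a S"
  unfolding eigensum_def by (meson UN_upper span_superset subset_trans)

lemma eigensum_mono: "S \<subseteq> T \<Longrightarrow> eigensum a S \<subseteq> eigensum a T"
  unfolding eigensum_def by (meson UN_mono order_refl span_mono)

lemma eigensum_empty: "eigensum a {} = {0}"
  by (simp add: eigensum_def)

lemma eigensum_insertE:
  assumes "x \<in> eigensum a (insert l S)"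
  obtains y z where "x = y + z" "y \<in> eigenspace a l" "z \<in> eigensum a S"
proof -
  have "eigensum a (insert l S) = span (eigenspace a l \<union> (\<Union>l\<in>S. eigenspace a l))"
    by (simp add: eigensum_def)
  also have "\<dots> = {x + y |x y. x \<in> span (eigenspace a l) \<and> y \<in> eigensum a S}"
    by (simp add: span_Un eigensum_def)
  finally show ?thesis using assms that subspace_eigenspace by (auto simp: span_eq_iff[THEN iffD2])
qed

lemma eigensum_singleton: "eigensum a {l} = eigenspace a l"
  by (simp add: eigensum_def span_eq_iff[THEN iffD2] subspace_eigenspace)

lemma eigensum_mult_closed: "x \<in> eigensum a S \<Longrightarrow> mult a x \<in> eigensum a S"
proof -
  assume x: "x \<in> eigensum a S"
  then show ?thesis unfolding eigensum_def
  proof (induction rule: span_induct)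
    case base
    then show ?case by (simp add: subspace_def bilinear span_zero span_add span_scale)
  next
    case (step x)
    then obtain l where "l \<in> S" "x \<in> eigenspace a l" by auto
    then have "mult a x = sc l x" "x \<in> span (\<Union>l\<in>S. eigenspace a l)"
      by (auto simp: mem_eigenspace intro!: span_base)
    then show ?case by (simp add: span_scale)
  qed
qed

text \<open>Subtracting \<open>l\<close> times a vector from its product with \<open>a\<close> kills
  the component at \<open>l\<close> and multiplies \<open>x\<close> by the nonzero scalar
  \<open>m - l\<close>, so the induction hypothesis for \<open>S\<close> applies.\<close>

lemma eigensum_eigenspace_Int:
  assumes "finite S" "m \<notin> S" "x \<in> eigensum a S" "x \<in> eigenspace a m"
  shows "x = 0"
  using assms
proof (induction S arbitrary: x rule: finite_induct)
  case empty
  then show ?case by (simp add: eigensum_empty)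
next
  case (insert l S)
  from insert.prems(2) obtain y z where yz: "x = y + z" "y \<in> eigenspace a l" "z \<in> eigensum a S"
    by (rule eigensum_insertE)
  have "sc (m - l) x = mult a z - sc l z"
    using yz insert.prems(3) by (simp add: mem_eigenspace bilinear scale_left_diff_distrib
        scale_right_distrib algebra_simps)
  also have "\<dots> \<in> eigensum a S"
    using yz(3) eigensum_mult_closed subspace_eigensum by (metis subspace_diff subspace_scale)
  finally have "sc (m - l) x \<in> eigensum a S" .
  moreover have "sc (m - l) x \<in> eigenspace a m"
    using insert.prems(3) subspace_eigenspace by (metis subspace_scale)
  ultimately have "sc (m - l) x = 0" using insert.IH insert.prems(1) by blast
  then show ?case using insert.prems(1) by auto
qed

lemma eigensum_eigenspace_unique:
  assumes "finite S" "m \<notin> S" "x + y = x' + y'" "x \<in> eigensum a S" "x' \<in> eigensum a S"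
    "y \<in> eigenspace a m" "y' \<in> eigenspace a m"
  shows "x = x'" "y = y'"
proof -
  have "x - x' = y' - y" using assms(3) by (simp add: algebra_simps)
  moreover have "x - x' \<in> eigensum a S" using assms subspace_eigensum subspace_diff by blast
  moreover have "y' - y \<in> eigenspace a m" using assms subspace_eigenspace subspace_diff by blast
  ultimately have "x - x' = 0" using eigensum_eigenspace_Int[OF assms(1,2)] by metis
  then show "x = x'" "y = y'" using assms(3) by auto
qed

end

section \<open>Gradings of the fusion law and the Miyamoto involution\<close>

locale monster_axis_algebra = comm_algebra sc mult
  for sc :: "'f::field \<Rightarrow> 'a::ab_group_add \<Rightarrow> 'a" and mult +
  fixes \<alpha> \<beta> :: 'f and a :: 'a
  assumes two: "(2::'f) \<noteq> 0"
    and \<alpha>0: "\<alpha> \<noteq> 0" and \<alpha>1: "\<alpha> \<noteq> 1" and \<beta>0: "\<beta> \<noteq> 0" and \<beta>1: "\<beta> \<noteq> 1" and \<alpha>\<beta>: "\<alpha> \<noteq> \<beta>"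
    and axis: "monster_axis \<alpha> \<beta> a"
begin

lemma idem: "mult a a = a"
  using axis by (simp add: primitive_axis_def)

lemma axis_eigenspace: "a \<in> eigenspace a 1"
  by (simp add: mem_eigenspace idem)

lemma eigenspace_1E:
  assumes "x \<in> eigenspace a 1"
  obtains t where "x = sc t a"
  using assms axis by (auto simp: primitive_axis_def)

lemma fusion:
  assumes "x \<in> eigenspace a l" "y \<in> eigenspace a m" "l \<in> {0, 1, \<alpha>, \<beta>}" "m \<in> {0, 1, \<alpha>, \<beta>}"
  shows "mult x y \<in> eigensum a (monster_star \<alpha> \<beta> l m)"
  using assms axis unfolding primitive_axis_def monster_set_def by blast

lemmas star_simps = monster_star_simps[OF \<alpha>0 \<alpha>1 \<beta>0 \<beta>1 \<alpha>\<beta>]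

lemma fusion_00: "x \<in> eigenspace a 0 \<Longrightarrow> y \<in> eigenspace a 0 \<Longrightarrow> mult x y \<in> eigenspace a 0"
  using fusion[of x 0 y 0] by (simp add: star_simps eigensum_singleton)

lemma fusion_0\<alpha>: "x \<in> eigenspace a 0 \<Longrightarrow> y \<in> eigenspace a \<alpha> \<Longrightarrow> mult x y \<in> eigenspace a \<alpha>"
  using fusion[of x 0 y \<alpha>] by (simp add: star_simps eigensum_singleton)

lemma fusion_\<alpha>\<alpha>: "x \<in> eigenspace a \<alpha> \<Longrightarrow> y \<in> eigenspace a \<alpha> \<Longrightarrow> mult x y \<in> eigensum a {0, 1}"
  using fusion[of x \<alpha> y \<alpha>] by (simp add: star_simps insert_commute)

text \<open>These are the eigenspaces of the Miyamoto involution for 1 and -1. The fusion law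
  respects this grading, because \<beta> occurs in a product of eigenvalues exactly when just one
  factor is \<beta>.\<close>

abbreviation Even :: "'a set" where "Even \<equiv> eigensum a {0, 1, \<alpha>}"
abbreviation Odd :: "'a set" where "Odd \<equiv> eigenspace a \<beta>"

lemma fusion_odd_odd: "x \<in> Odd \<Longrightarrow> y \<in> Odd \<Longrightarrow> mult x y \<in> Even"
  using fusion[of x \<beta> y \<beta>] by (simp add: star_simps insert_commute)

lemma fusion_even_odd:
  assumes "x \<in> Even" "y \<in> Odd"
  shows "mult x y \<in> Odd"
  using assms(1) unfolding eigensum_def
proof (induction rule: span_induct)
  case base
  then show ?case using subspace_eigenspace[of a \<beta>]
    by (auto simp: subspace_def bilinear)
next
  case (step x)
  then obtain l where l: "l \<in> {0, 1, \<alpha>}" "x \<in> eigenspace a l" by auto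
  then have "mult x y \<in> eigensum a (monster_star \<alpha> \<beta> l \<beta>)" using fusion assms(2) by auto
  then show ?case using l(1) by (auto simp: star_simps eigensum_singleton)
qed

lemma fusion_even_even:
  assumes "x \<in> Even" "y \<in> Even"
  shows "mult x y \<in> Even"
  using assms(1) unfolding eigensum_def[of a "{0,1,\<alpha>}"]
proof (induction rule: span_induct)
  case base
  then show ?case unfolding eigensum_def[symmetric] using subspace_eigensum[of a "{0,1,\<alpha>}"]
    by (auto simp: subspace_def bilinear)
next
  case (step x)
  then obtain l where l: "l \<in> {0, 1, \<alpha>}" "x \<in> eigenspace a l" by auto
  show ?case unfolding eigensum_def[symmetric] using assms(2) unfolding eigensum_def[of a "{0,1,\<alpha>}"]
  proof (induction rule: span_induct)
    case base
    then show ?case unfolding eigensum_def[symmetric] using subspace_eigensum[of a "{0,1,\<alpha>}"]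
      by (auto simp: subspace_def bilinear)
  next
    case (step y)
    then obtain m where m: "m \<in> {0, 1, \<alpha>}" "y \<in> eigenspace a m" by auto
    have "monster_star \<alpha> \<beta> l m \<subseteq> {0, 1, \<alpha>}" using l(1) m(1) \<alpha>0 \<alpha>1 \<beta>0 \<beta>1 \<alpha>\<beta>
      by (auto simp: monster_star_def doubleton_eq_iff)
    then show ?case unfolding eigensum_def[symmetric]
      using fusion[OF l(2) m(2)] l(1) m(1) eigensum_mono by blast
  qed
qed

lemma parity_unique:
  assumes "x + y = x' + y'" "x \<in> Even" "x' \<in> Even" "y \<in> Odd" "y' \<in> Odd"
  shows "x = x'" "y = y'"
  using eigensum_eigenspace_unique[of "{0, 1, \<alpha>}" \<beta>, OF _ _ assms] \<beta>0 \<beta>1 \<alpha>\<beta> by auto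

text \<open>Inside \<open>Even\<close> the fusion law is graded once more, with \<alpha> as the odd
  eigenvalue. Relations without \<beta>-part are split by this second grading.\<close>

lemma jordan_unique:
  assumes "x + y = x' + y'" "x \<in> eigensum a {0, 1}" "x' \<in> eigensum a {0, 1}"
    "y \<in> eigenspace a \<alpha>" "y' \<in> eigenspace a \<alpha>"
  shows "x = x'" "y = y'"
  using eigensum_eigenspace_unique[of "{0, 1}" \<alpha>, OF _ _ assms] \<alpha>0 \<alpha>1 by auto

lemma even_decomp:
  assumes "x \<in> Even"
  obtains t y z where "x = sc t a + y + z" "y \<in> eigenspace a 0" "z \<in> eigenspace a \<alpha>"
proof -
  from assms obtain y x' where 1: "x = y + x'" "y \<in> eigenspace a 0" "x' \<in> eigensum a {1, \<alpha>}"
    by (rule eigensum_insertE)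
  from 1(3) obtain w z where 2: "x' = w + z" "w \<in> eigenspace a 1" "z \<in> eigensum a {\<alpha>}"
    by (rule eigensum_insertE)
  from 2(2) obtain t where "w = sc t a" by (rule eigenspace_1E)
  then show ?thesis using that[of t y z] 1 2 by (simp add: eigensum_singleton algebra_simps)
qed

lemma parity_decomp:
  obtains y z where "x = y + z" "y \<in> Even" "z \<in> Odd"
proof -
  have "x \<in> eigensum a (insert \<beta> {0, 1, \<alpha>})"
    using axis by (simp add: primitive_axis_def monster_set_def insert_commute)
  then obtain y z where "x = y + z" "y \<in> Odd" "z \<in> Even" by (rule eigensum_insertE)
  then show ?thesis using that[of z y] by (simp add: add.commute)
qed

text \<open>Since \<open>miyamoto\<close> is a definite description, existence and uniqueness of the
  map are both needed. The map \<open>T\<close> is read off from a chosen parity decomposition, and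
  \<open>parity_unique\<close> makes it independent of the choice, hence linear.\<close>

lemma miyamoto_eq:
  assumes "x \<in> Even" "y \<in> Odd"
  shows "miyamoto \<alpha> \<beta> a (x + y) = x - y"
proof -
  define P where "P t \<longleftrightarrow> Vector_Spaces.linear sc sc t \<and>
     (\<forall>x\<in>Even. t x = x) \<and> (\<forall>x\<in>Odd. t x = - x)" for t
  have P_eq: "t (x + y) = x - y" if "P t" "x \<in> Even" "y \<in> Odd" for t x y
  proof -
    interpret t: Vector_Spaces.linear sc sc t using that(1) by (simp add: P_def)
    show ?thesis using that by (simp add: P_def t.add)
  qed
  define T where "T x = (SOME u. \<exists>y\<in>Even. \<exists>z\<in>Odd. x = y + z \<and> u = y - z)" for x
  have T: "T (y + z) = y - z" if "y \<in> Even" "z \<in> Odd" for y z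
    unfolding T_def
  proof (rule some_equality)
    fix u assume "\<exists>y'\<in>Even. \<exists>z'\<in>Odd. y + z = y' + z' \<and> u = y' - z'"
    then obtain y' z' where "y' \<in> Even" "z' \<in> Odd" "y + z = y' + z'" "u = y' - z'" by blast
    then show "u = y - z" using parity_unique[of y z y' z'] that by simp
  qed (use that in blast)
  have "P T" unfolding P_def
  proof (intro conjI ballI)
    show "Vector_Spaces.linear sc sc T"
    proof (unfold_locales)
      fix u v
      obtain y z where u: "u = y + z" "y \<in> Even" "z \<in> Odd" by (rule parity_decomp)
      obtain y' z' where v: "v = y' + z'" "y' \<in> Even" "z' \<in> Odd" by (rule parity_decomp)
      have "u + v = (y + y') + (z + z')" using u v by (simp add: algebra_simps)
      moreover have "y + y' \<in> Even" "z + z' \<in> Odd"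
        using u v subspace_eigensum subspace_eigenspace subspace_add by blast+
      ultimately show "T (u + v) = T u + T v" using T u v by (simp only: add_diff_add)
    next
      fix c u
      obtain y z where u: "u = y + z" "y \<in> Even" "z \<in> Odd" by (rule parity_decomp)
      have "sc c y \<in> Even" "sc c z \<in> Odd"
        using u subspace_eigensum subspace_eigenspace subspace_scale by blast+
      then show "T (sc c u) = sc c (T u)"
        using T u by (simp add: scale_right_distrib scale_right_diff_distrib)
    qed
    show "T x = x" if "x \<in> Even" for x
      using T[OF that, of 0] subspace_0[OF subspace_eigenspace] by simp
    show "T x = - x" if "x \<in> Odd" for x
      using T[OF _ that, of 0] subspace_0[OF subspace_eigensum] by simp
  qed
  moreover have "t = T" if "P t" for t
  proof
    fix u
    obtain y z where u: "u = y + z" "y \<in> Even" "z \<in> Odd" by (rule parity_decomp)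
    then show "t u = T u" using P_eq[OF that] P_eq[OF \<open>P T\<close>] by simp
  qed
  ultimately have "miyamoto \<alpha> \<beta> a = T" unfolding miyamoto_def P_def[symmetric]
    by (rule the_equality)
  then show ?thesis using T assms by simp
qed

text \<open>The odd part \<open>z\<close> of a fixed vector satisfies \<open>2 z = 0\<close>, so it
  vanishes outside characteristic 2.\<close>

lemma miyamoto_fixed:
  assumes "miyamoto \<alpha> \<beta> a x = x"
  shows "x \<in> Even"
proof -
  obtain y z where x: "x = y + z" "y \<in> Even" "z \<in> Odd" by (rule parity_decomp)
  then have "y - z = y + z" using assms miyamoto_eq by simp
  then have "z + z = 0" by (simp add: algebra_simps)
  then have "sc 2 z = 0" using scale_left_distrib[of 1 1 z] by simp
  then show ?thesis using two x by simp
qed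

lemma subalgebra_Even: "subalgebra Even"
  unfolding subalgebra_def using fusion_even_even subspace_eigensum by blast

end

section \<open>Characteristic 5 and algebras given by a multiplication table\<close>

lemma five_neq_zero_of_CHAR:
  assumes "CHAR('f::field) \<noteq> 5"
  shows "(5::'f) \<noteq> 0"
proof
  assume "(5::'f) = 0"
  then have "of_nat 5 = (0::'f)" by simp
  then have d: "CHAR('f) dvd 5" by (simp only: of_nat_eq_0_iff_char_dvd)
  then have "CHAR('f) \<le> 5" by (simp add: dvd_imp_le)
  moreover have "x = 0 \<or> x = 1 \<or> x = 2 \<or> x = 3 \<or> x = 4 \<or> x = 5" if "x \<le> 5" for x :: nat
    using that by presburger
  ultimately have "CHAR('f) \<in> {0, 1, 2, 3, 4, 5}" by blast
  then show False using assms d CHAR_not_1' by auto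
qed

text \<open>A rewrite rule that reduces large numerals modulo 5. The lower bound on the numeral
  keeps the simplifier from looping on numerals that are already reduced.\<close>

lemma numeral_mod_5:
  assumes "(5::'f::field) = 0" "(5::nat) \<le> numeral n"
  shows "(numeral n :: 'f) = of_nat (numeral n mod 5)"
proof -
  have "(numeral n :: 'f) = of_nat (5 * (numeral n div 5) + numeral n mod 5)"
    by (simp only: mult_div_mod_eq of_nat_numeral)
  also have "\<dots> = 5 * of_nat (numeral n div 5) + of_nat (numeral n mod 5)"
    by (simp only: of_nat_add of_nat_mult of_nat_numeral)
  finally show ?thesis using assms(1) by simp
qed

text \<open>The linear map \<open>g\<close> sending basis vector \<open>i\<close> to
  \<open>v i\<close> is multiplicative by bilinearity and injective by independence. Its range is a
  subalgebra containing the generators, so surjectivity needs no dimension count. The isomorphism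
  itself is the inverse of \<open>g\<close>.\<close>

lemma (in comm_algebra) algebra_iso_table_mult:
  fixes v :: "'i::finite \<Rightarrow> 'a" and T :: "'i \<Rightarrow> 'i \<Rightarrow> 'f ^ 'i"
  assumes table: "\<And>i j. mult (v i) (v j) = (\<Sum>k\<in>UNIV. sc (T i j $ k) (v k))"
    and indep: "\<And>c k. (\<Sum>k\<in>UNIV. sc (c k) (v k)) = 0 \<Longrightarrow> c k = 0"
    and generates: "subalgebra hull X = UNIV"
    and X: "\<And>x. x \<in> X \<Longrightarrow> \<exists>c. x = (\<Sum>k\<in>UNIV. sc (c k) (v k))"
  shows "algebra_iso sc mult (*s) (table_mult T)"
proof -
  define g where "g u = (\<Sum>k\<in>UNIV. sc (u $ k) (v k))" for u :: "'f ^ 'i"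
  have g_add: "g (u + w) = g u + g w" for u w
    by (simp add: g_def scale_left_distrib sum.distrib)
  have g_scale: "g (r *s u) = sc r (g u)" for r u
    by (simp add: g_def scale_sum_right)
  have g_sum: "g (\<Sum>i\<in>I. h i) = (\<Sum>i\<in>I. g (h i))" if "finite I" for I :: "'i set" and h
    using that by (induction rule: finite_induct) (simp_all add: g_add, simp add: g_def)
  have mult_sum_right: "mult x (\<Sum>i\<in>I. h i)
      = (\<Sum>i\<in>I. mult x (h i))" if "finite I" for x h and I :: "'i set"
    using that by (induction rule: finite_induct) (simp_all add: bilinear)
  have mult_sum_left: "mult (\<Sum>i\<in>I. h i) x
      = (\<Sum>i\<in>I. mult (h i) x)" if "finite I" for x h and I :: "'i set"
    using that by (induction rule: finite_induct) (simp_all add: bilinear)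
  have g_mult: "g (table_mult T u w) = mult (g u) (g w)" for u w
  proof -
    have "g (table_mult T u w)
        = (\<Sum>i\<in>UNIV. \<Sum>j\<in>UNIV. sc (u $ i * w $ j) (g (T i j)))"
      by (simp add: table_mult_def g_sum g_scale)
    also have "\<dots> = (\<Sum>i\<in>UNIV. \<Sum>j\<in>UNIV. sc (u $ i) (sc (w $ j) (mult (v i) (v j))))"
      by (simp add: g_def table)
    also have "\<dots> = (\<Sum>i\<in>UNIV. sc (u $ i) (mult (v i) (g w)))"
      by (simp add: g_def mult_sum_right mult_scale_right scale_sum_right)
    also have "\<dots> = mult (g u) (g w)"
      by (simp add: g_def[of u] mult_sum_left mult_scale_left)
    finally show ?thesis .
  qed
  have "inj g"
  proof (rule injI)
    fix u w assume "g u = g w"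
    then have "(\<Sum>k\<in>UNIV. sc (u $ k - w $ k) (v k)) = 0"
      by (simp add: g_def scale_left_diff_distrib sum_subtractf)
    then have "u $ k - w $ k = 0" for k by (rule indep)
    then show "u = w" by (simp add: vec_eq_iff)
  qed
  moreover have "surj g"
  proof -
    have "subspace (range g)"
    proof (rule subspaceI)
      have "g 0 = 0" by (simp add: g_def)
      then show "0 \<in> range g" by (metis rangeI)
      show "x + y \<in> range g" if "x \<in> range g" "y \<in> range g" for x y
        using that by (auto simp flip: g_add)
      show "sc r x \<in> range g" if "x \<in> range g" for r x
        using that by (auto simp flip: g_scale)
    qed
    moreover have "mult x y \<in> range g" if "x \<in> range g" "y \<in> range g" for x y
      using that by (auto simp flip: g_mult)
    ultimately have "subalgebra (range g)"
      unfolding subalgebra_def by blast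
    moreover have "X \<subseteq> range g"
    proof
      fix x assume "x \<in> X"
      then obtain c where "x = (\<Sum>k\<in>UNIV. sc (c k) (v k))" using X by blast
      then have "x = g (\<chi> k. c k)" by (simp add: g_def)
      then show "x \<in> range g" by blast
    qed
    ultimately have "subalgebra hull X \<subseteq> range g" by (simp add: hull_minimal)
    then show ?thesis using generates by auto
  qed
  ultimately have bij: "bij g" by (simp add: bij_def)
  then have g_inv: "g (inv g x) = x" and inv_g: "inv g (g u) = u" for x u
    by (auto intro: surj_f_inv_f inv_f_f dest: bij_is_surj bij_is_inj)
  have "Vector_Spaces.linear sc (*s) (inv g)"
  proof (unfold_locales)
    show "inv g (x + y) = inv g x + inv g y" for x y
      using inv_g[of "inv g x + inv g y"] by (simp add: g_add g_inv)
    show "inv g (sc r x) = r *s inv g x" for r x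
      using inv_g[of "r *s inv g x"] by (simp add: g_scale g_inv)
  qed
  moreover have "inv g (mult x y) = table_mult T (inv g x) (inv g y)" for x y
    using inv_g[of "table_mult T (inv g x) (inv g y)"] by (simp add: g_mult g_inv)
  ultimately show ?thesis unfolding algebra_iso_def using bij bij_imp_bij_inv by blast
qed

lemma UNIV_idx3C: "UNIV = {Bx, By, Bz}"
  using idx3C.exhaust by auto

lemma UNIV_idxQ2: "UNIV = {S1, S2, D1, D2}"
  using idxQ2.exhaust by auto

lemma UNIV_idxQ2x: "UNIV = {Ex, Ey, Ez, E1}"
  using idxQ2x.exhaust by auto

section \<open>The relations of a skew pair\<close>

text \<open>Here \<open>p = b + c\<close> and \<open>e = b - c\<close> with \<open>c = \<tau>\<^sub>a b\<close>.  The vectors \<open>p0\<close>, \<open>p1\<close> are the \<open>0\<close>- and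
  \<open>\<alpha>\<close>-parts of \<open>p\<close> with respect to \<open>a\<close>; the other indexed vectors are parts with respect to \<open>b\<close>.\<close>

locale skew_pair = monster_axis_algebra sc mult \<alpha> \<beta> a + b: monster_axis_algebra sc mult \<alpha> \<beta> b
  for sc :: "'f::field \<Rightarrow> 'a::ab_group_add \<Rightarrow> 'a" and mult \<alpha> \<beta> a b +
  fixes p p0 p1 a0 a1 e e0 e1 :: 'a and \<nu> \<mu> \<psi> :: 'f
  assumes two_b: "sc 2 b = p + e"
    and e_odd: "e \<in> eigenspace a \<beta>" and e_neq_0: "e \<noteq> 0"
    and p_decomp: "p = sc \<nu> a + p0 + p1"
    and p0: "p0 \<in> eigenspace a 0" and p1: "p1 \<in> eigenspace a \<alpha>"
    and a_decomp: "a = sc \<mu> b + a0 + a1"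
    and a0: "a0 \<in> eigenspace b 0" and a1: "a1 \<in> eigenspace b \<alpha>"
    and e_decomp: "e = sc \<psi> b + e0 + e1"
    and e0: "e0 \<in> eigenspace b 0" and e1: "e1 \<in> eigenspace b \<alpha>"
    and generates: "subalgebra hull {a, b} = UNIV"
begin

lemma p_even: "p \<in> Even"
proof -
  have "a \<in> Even" "p0 \<in> Even" "p1 \<in> Even"
    using axis_eigenspace p0 p1 eigenspace_subset_eigensum[of _ "{0, 1, \<alpha>}" a] by blast+
  then show ?thesis unfolding p_decomp
    by (intro subspace_add[OF subspace_eigensum] subspace_scale[OF subspace_eigensum])
qed

definition "q = mult a p"
definition "f = mult e e"
text \<open>The vector \<open>e\<close> will turn out to be an eigenvector of multiplication by
  \<open>q\<close> and by \<open>f\<close>; \<theta> and \<epsilon> are the eigenvalues, see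
  \<open>qe\<close> and \<open>fe\<close>.\<close>

definition "\<theta> = 2 * \<alpha> * \<beta> - \<beta> + 2 * (1 - \<alpha>) * \<mu>"
definition "\<epsilon> = 2 * \<alpha> - 1 + 2 * (1 - \<alpha>) * \<psi>"

lemma ae: "mult a e = sc \<beta> e"
  using e_odd by (simp add: mem_eigenspace)

lemma ap: "mult a p = q"
  by (simp add: q_def)

lemma ee: "mult e e = f"
  by (simp add: f_def)

lemma b_neq_0: "b \<noteq> 0"
proof
  assume "b = 0"
  then have "p + e = 0 + 0" using two_b by simp
  then have "e = 0" using parity_unique(2)[of p e 0 0] p_even e_odd
    by (simp add: subspace_0[OF subspace_eigensum] subspace_0[OF subspace_eigenspace])
  then show False using e_neq_0 by simp
qed

lemma f_even: "f \<in> Even" unfolding f_def using e_odd by (rule fusion_odd_odd[OF _ e_odd])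

lemma a_even: "a \<in> Even"
  using axis_eigenspace eigenspace_subset_eigensum[of 1 "{0, 1, \<alpha>}" a] by blast

lemma q_even: "q \<in> Even"
  unfolding q_def using a_even p_even by (rule fusion_even_even)

lemmas closed = subspace_add[OF subspace_eigensum] subspace_scale[OF subspace_eigensum]
  subspace_diff[OF subspace_eigensum] subspace_add[OF subspace_eigenspace]
  subspace_scale[OF subspace_eigenspace] subspace_diff[OF subspace_eigenspace]
  subspace_neg[OF subspace_eigenspace] subspace_0[OF subspace_eigensum]
  subspace_0[OF subspace_eigenspace]

lemmas parity_mem = closed p_even a_even q_even f_even e_odd
  fusion_even_even fusion_even_odd fusion_odd_odd

lemma ba0: "mult b a0 = 0" and ba1: "mult b a1 = sc \<alpha> a1"
  and be0: "mult b e0 = 0" and be1: "mult b e1 = sc \<alpha> e1"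
  using a0 a1 e0 e1 by (simp_all add: mem_eigenspace)

lemma ap0: "mult a p0 = 0" and ap1: "mult a p1 = sc \<alpha> p1"
  using p0 p1 by (simp_all add: mem_eigenspace)

lemma ab: "mult a b = sc \<mu> b + sc \<alpha> a1"
proof -
  have "mult b a = mult b (sc \<mu> b + a0 + a1)" by (simp only: a_decomp[symmetric])
  then show ?thesis by (simp add: bilinear b.idem ba0 ba1 mult_commute[of a b])
qed

lemma be: "mult b e = sc \<psi> b + sc \<alpha> e1"
proof -
  have "mult b e = mult b (sc \<psi> b + e0 + e1)" by (simp only: e_decomp[symmetric])
  then show ?thesis by (simp add: bilinear b.idem be0 be1)
qed

lemma q_eq: "q = sc \<nu> a + sc \<alpha> p1"
proof -
  have "mult a p = mult a (sc \<nu> a + p0 + p1)" by (simp only: p_decomp[symmetric])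
  then show ?thesis by (simp add: bilinear idem ap0 ap1 ap)
qed

lemmas products_left = ae ap ee ba0 ba1 be0 be1 ap0 ap1 idem b.idem
lemmas products = products_left products_left[THEN mult_swap]

section \<open>Products of \<open>a\<close>, \<open>p\<close>, \<open>e\<close>, \<open>q\<close>
  and \<open>f\<close>\<close>

lemma aq: "mult a q = sc \<alpha> q + sc ((1 - \<alpha>) * \<nu>) a"
proof (rule vec_eqI)
  fix l :: "'a \<Rightarrow> 'f" assume l: "Vector_Spaces.linear sc (*) l"
  note L = functional_simps[OF l] bilinear products mult_commute
  show "l (mult a q) = l (sc \<alpha> q + sc ((1 - \<alpha>) * \<nu>) a)"
    by (simp only: L q_eq) algebra
qed

lemma two_ab: "sc 2 (mult a b) = q + sc \<beta> e"
proof -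
  have "mult a (sc 2 b) = mult a (p + e)" by (simp only: two_b)
  then show ?thesis by (simp add: bilinear ap ae)
qed

text \<open>Four times the idempotence of \<open>b\<close> reads
  \<open>(p + e)(p + e) = 2 p + 2 e\<close>. Both equations are parity components of this.\<close>

lemma pp: "mult p p = sc 2 p - f" and pe: "mult p e = e"
proof -
  have X: "mult (sc 2 b) (sc 2 b) = mult (p + e) (p + e)" by (simp only: two_b)
  have *: "(mult p p + f) + sc 2 (mult p e) = sc 2 p + sc 2 e"
    (is "?L = ?R")
  proof (rule vec_eqI)
    fix l :: "'a \<Rightarrow> 'f" assume l: "Vector_Spaces.linear sc (*) l"
    note L = functional_simps[OF l] bilinear products mult_commute
    show "l ?L = l ?R"
      using arg_cong[OF X, of l] arg_cong[OF two_b, of l] by (simp only: L) algebra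
  qed
  have "mult p p + f = sc 2 p" "sc 2 (mult p e) = sc 2 e"
    using parity_unique[OF *] by (simp_all add: parity_mem)
  then show "mult p p = sc 2 p - f" "mult p e = e"
    using two by (simp_all add: eq_diff_eq)
qed

lemma two_be: "sc 2 (mult b e) = f + e"
proof -
  have "mult (sc 2 b) e = mult (p + e) e" by (simp only: two_b)
  then show ?thesis by (simp add: bilinear pe ee add.commute)
qed

text \<open>With respect to \<open>b\<close> the product \<open>ab\<close> has no 0-part, so
  \<open>b(ab)\<close> equals \<alpha> times \<open>ab\<close> plus a multiple of \<open>b\<close>.
  Written with \<open>2 b = p + e\<close> and \<open>two_ab\<close>, its even part yields
  \<open>pq\<close> and its odd part \<open>qe\<close>.\<close>

lemma pq: "mult p q = sc (2 * \<alpha>) q - sc \<beta> f + sc (2 * (1 - \<alpha>) * \<mu>) p"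
  and qe: "mult q e = sc \<theta> e"
proof -
  have X: "mult (sc 2 b) (sc 2 (mult a b)) = mult (p + e) (q + sc \<beta> e)"
    by (simp only: two_b two_ab)
  have Y: "mult b (mult a b) = mult b (sc \<mu> b + sc \<alpha> a1)" by (simp only: ab)
  have *: "(mult p q + sc \<beta> f) + mult q e
      = (sc (2 * \<alpha>) q + sc (2 * (1 - \<alpha>) * \<mu>) p) + sc \<theta> e"
    (is "?L = ?R")
  proof (rule vec_eqI)
    fix l :: "'a \<Rightarrow> 'f" assume l: "Vector_Spaces.linear sc (*) l"
    note L = functional_simps[OF l] bilinear products mult_commute pe pe[THEN mult_swap] \<theta>_def
    show "l ?L = l ?R"
      using arg_cong[OF X, of l] arg_cong[OF Y, of l] arg_cong[OF ab, of l]
        arg_cong[OF two_ab, of l] arg_cong[OF two_b, of l]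
      by (simp only: L) algebra
  qed
  have "mult p q + sc \<beta> f = sc (2 * \<alpha>) q + sc (2 * (1 - \<alpha>) * \<mu>) p"
    and "mult q e = sc \<theta> e"
    using parity_unique[OF *] by (simp_all add: parity_mem)
  then show "mult p q = sc (2 * \<alpha>) q - sc \<beta> f + sc (2 * (1 - \<alpha>) * \<mu>) p"
    and "mult q e = sc \<theta> e"
    by (simp_all add: algebra_simps)
qed

text \<open>The product \<open>be\<close> has no 0-part for \<open>b\<close> either, so the argument
  for \<open>qe\<close> is repeated with \<open>b(be)\<close>.\<close>

lemma fe: "mult f e = sc \<epsilon> e"
proof -
  have X: "mult (sc 2 b) (sc 2 (mult b e)) = mult (p + e) (f + e)"
    by (simp only: two_b two_be)
  have Y: "mult b (mult b e) = mult b (sc \<psi> b + sc \<alpha> e1)" by (simp only: be)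
  have *: "(mult p f + f) + (mult f e + e)
      = (sc (2 * \<alpha>) f + sc (2 * (1 - \<alpha>) * \<psi>) p) + sc (2 * \<alpha> + 2 * (1 - \<alpha>) * \<psi>) e"
    (is "?L = ?R")
  proof (rule vec_eqI)
    fix l :: "'a \<Rightarrow> 'f" assume l: "Vector_Spaces.linear sc (*) l"
    note L = functional_simps[OF l] bilinear products mult_commute pe pe[THEN mult_swap]
    show "l ?L = l ?R"
      using arg_cong[OF X, of l] arg_cong[OF Y, of l] arg_cong[OF be, of l]
        arg_cong[OF two_be, of l] arg_cong[OF two_b, of l]
      by (simp only: L) algebra
  qed
  have "mult f e + e = sc (2 * \<alpha> + 2 * (1 - \<alpha>) * \<psi>) e"
    using parity_unique(2)[OF *] by (simp add: parity_mem)
  then show ?thesis by (simp add: \<epsilon>_def scale_left_distrib scale_left_diff_distrib eq_diff_eq add_diff_eq algebra_simps)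
qed

section \<open>Comparison of components with respect to \<open>b\<close>\<close>

lemma b_mem: "b \<in> eigensum b {0, 1}" "a0 \<in> eigensum b {0, 1}" "e0 \<in> eigensum b {0, 1}"
  "mult a0 a0 \<in> eigensum b {0, 1}" "mult a1 a1 \<in> eigensum b {0, 1}"
  "mult a0 e0 \<in> eigensum b {0, 1}" "mult a1 e1 \<in> eigensum b {0, 1}"
  "mult e0 e0 \<in> eigensum b {0, 1}" "mult e1 e1 \<in> eigensum b {0, 1}"
  using b.axis_eigenspace a0 a1 e0 e1 b.fusion_00 b.fusion_\<alpha>\<alpha>
    eigenspace_subset_eigensum[of _ "{0, 1}" b] by blast+

lemma b_mem_\<alpha>: "mult a0 a1 \<in> eigenspace b \<alpha>" "mult a0 e1 \<in> eigenspace b \<alpha>"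
  "mult e0 a1 \<in> eigenspace b \<alpha>" "mult e0 e1 \<in> eigenspace b \<alpha>"
  using a0 a1 e0 e1 b.fusion_0\<alpha> by blast+

lemmas jordan_mem = closed b_mem b_mem_\<alpha> a1 e1

lemma b_coefficient:
  assumes "sc s b + x = sc t b + y" "x \<in> eigenspace b 0" "y \<in> eigenspace b 0"
  shows "s = t" "x = y"
proof -
  have *: "x + sc s b = y + sc t b" using assms(1) by (simp add: add.commute)
  have "sc s b \<in> eigenspace b 1" "sc t b \<in> eigenspace b 1"
    using b.axis_eigenspace by (simp_all add: closed)
  then have "x = y" "sc s b = sc t b"
    using eigensum_eigenspace_unique[OF _ _ *, of "{0}" 1 b] assms(2,3)
    by (simp_all add: eigensum_singleton)
  then show "s = t" "x = y" using b_neq_0 by simp_all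
qed

text \<open>The idempotence of \<open>a\<close> is expanded in \<open>b\<close>-eigenvectors. By
  fusion \<open>a0 a0\<close> and \<open>a1 a1\<close> have no \<alpha>-part and
  \<open>a0 a1\<close> is purely an \<alpha>-vector, so the equation splits in two.\<close>

lemma aa_01: "sc (\<mu>\<^sup>2) b + mult a0 a0 + mult a1 a1 = sc \<mu> b + a0"
  and aa_\<alpha>: "sc (2 * \<alpha> * \<mu>) a1 + sc 2 (mult a0 a1) = a1"
proof -
  have X: "mult (sc \<mu> b + a0 + a1) (sc \<mu> b + a0 + a1) = (sc \<mu> b + a0 + a1)"
    using idem by (simp only: a_decomp[symmetric])
  have *: "(sc (\<mu>\<^sup>2) b + mult a0 a0 + mult a1 a1) + (sc (2 * \<alpha> * \<mu>) a1 + sc 2 (mult a0 a1))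
      = (sc \<mu> b + a0) + a1"
    (is "?L = ?R")
  proof (rule vec_eqI)
    fix l :: "'a \<Rightarrow> 'f" assume l: "Vector_Spaces.linear sc (*) l"
    note L = functional_simps[OF l] bilinear products mult_commute
    show "l ?L = l ?R"
      using arg_cong[OF X, of l] by (simp only: L) algebra
  qed
  show "sc (\<mu>\<^sup>2) b + mult a0 a0 + mult a1 a1 = sc \<mu> b + a0"
    and "sc (2 * \<alpha> * \<mu>) a1 + sc 2 (mult a0 a1) = a1"
    using b.jordan_unique[OF *] by (simp_all add: jordan_mem)
qed

text \<open>The product \<open>a(ab)\<close> is computed twice: once in \<open>b\<close>-components,
  and once from \<open>two_ab\<close> and \<open>aq\<close>. Eliminating \<open>q\<close> from the
  second result leaves multiples of \<open>ab\<close>, \<open>a\<close> and \<open>e\<close>, the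
  last with coefficient \<beta>(\<beta> - \<alpha>).\<close>

lemma aab_01: "sc (2 * \<mu>\<^sup>2) b + sc (2 * \<alpha>) (mult a1 a1)
    = sc (2 * \<alpha> * \<mu> + (1 - \<alpha>) * \<nu> * \<mu> + \<beta> * (\<beta> - \<alpha>) * \<psi>) b + (sc ((1 - \<alpha>) * \<nu>) a0 + sc (\<beta> * (\<beta> - \<alpha>)) e0)"
  and aab_\<alpha>: "sc (2 * \<mu> * \<alpha> + 2 * \<mu> * \<alpha>\<^sup>2) a1 + sc (2 * \<alpha>) (mult a0 a1)
      = sc (2 * \<alpha>\<^sup>2 + (1 - \<alpha>) * \<nu>) a1 + sc (\<beta> * (\<beta> - \<alpha>)) e1"
proof -
  have X: "mult a (sc 2 (mult a b)) = mult a (q + sc \<beta> e)" by (simp only: two_ab)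
  have Y: "mult a (mult a b) = mult (sc \<mu> b + a0 + a1) (sc \<mu> b + sc \<alpha> a1)"
    by (simp only: ab a_decomp[symmetric])
  have *: "(sc (2 * \<mu>\<^sup>2) b + sc (2 * \<alpha>) (mult a1 a1)) + (sc (2 * \<mu> * \<alpha> + 2 * \<mu> * \<alpha>\<^sup>2) a1 + sc (2 * \<alpha>) (mult a0 a1))
      = (sc (2 * \<alpha> * \<mu> + (1 - \<alpha>) * \<nu> * \<mu> + \<beta> * (\<beta> - \<alpha>) * \<psi>) b + (sc ((1 - \<alpha>) * \<nu>) a0 + sc (\<beta> * (\<beta> - \<alpha>)) e0)) + (sc (2 * \<alpha>\<^sup>2 + (1 - \<alpha>) * \<nu>) a1 + sc (\<beta> * (\<beta> - \<alpha>)) e1)"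
    (is "?L = ?R")
  proof (rule vec_eqI)
    fix l :: "'a \<Rightarrow> 'f" assume l: "Vector_Spaces.linear sc (*) l"
    note L = functional_simps[OF l] bilinear products mult_commute aq aq[THEN mult_swap]
    show "l ?L = l ?R"
      using arg_cong[OF X, of l] arg_cong[OF Y, of l] arg_cong[OF ab, of l]
        arg_cong[OF two_ab, of l] arg_cong[OF a_decomp, of l] arg_cong[OF e_decomp, of l]
      by (simp only: L) algebra
  qed
  show "sc (2 * \<mu>\<^sup>2) b + sc (2 * \<alpha>) (mult a1 a1)
      = sc (2 * \<alpha> * \<mu> + (1 - \<alpha>) * \<nu> * \<mu> + \<beta> * (\<beta> - \<alpha>) * \<psi>) b + (sc ((1 - \<alpha>) * \<nu>) a0 + sc (\<beta> * (\<beta> - \<alpha>)) e0)"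
    and "sc (2 * \<mu> * \<alpha> + 2 * \<mu> * \<alpha>\<^sup>2) a1 + sc (2 * \<alpha>) (mult a0 a1)
        = sc (2 * \<alpha>\<^sup>2 + (1 - \<alpha>) * \<nu>) a1 + sc (\<beta> * (\<beta> - \<alpha>)) e1"
    using b.jordan_unique[OF *] by (simp_all add: jordan_mem)
qed

text \<open>Here \<open>e(ab)\<close> is computed twice. On the \<open>a\<close>-side
  \<open>qe\<close> applies, and \<open>f\<close> is eliminated as \<open>2 be - e\<close>.\<close>

lemma eab_01: "sc (2 * \<mu> * \<psi>) b + sc (2 * \<alpha>) (mult a1 e1)
    = sc ((\<theta> + \<beta>) * \<psi>) b + sc (\<theta> - \<beta>) e0"
  and eab_\<alpha>: "sc (2 * \<mu> * \<alpha>) e1 + sc (2 * \<alpha>\<^sup>2 * \<psi>) a1 + sc (2 * \<alpha>) (mult e0 a1)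
      = sc (\<theta> + (2 * \<alpha> - 1) * \<beta>) e1"
proof -
  have X: "mult e (sc 2 (mult a b)) = mult e (q + sc \<beta> e)" by (simp only: two_ab)
  have Y: "mult e (mult a b) = mult (sc \<psi> b + e0 + e1) (sc \<mu> b + sc \<alpha> a1)"
    by (simp only: ab e_decomp[symmetric])
  have *: "(sc (2 * \<mu> * \<psi>) b + sc (2 * \<alpha>) (mult a1 e1)) + (sc (2 * \<mu> * \<alpha>) e1 + sc (2 * \<alpha>\<^sup>2 * \<psi>) a1 + sc (2 * \<alpha>) (mult e0 a1))
      = (sc ((\<theta> + \<beta>) * \<psi>) b + sc (\<theta> - \<beta>) e0) + (sc (\<theta> + (2 * \<alpha> - 1) * \<beta>) e1)"
    (is "?L = ?R")
  proof (rule vec_eqI)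
    fix l :: "'a \<Rightarrow> 'f" assume l: "Vector_Spaces.linear sc (*) l"
    note L = functional_simps[OF l] bilinear products mult_commute qe qe[THEN mult_swap]
    show "l ?L = l ?R"
      using arg_cong[OF X, of l] arg_cong[OF Y, of l] arg_cong[OF two_be, of l]
        arg_cong[OF be, of l] arg_cong[OF e_decomp, of l]
      by (simp only: L) algebra
  qed
  show "sc (2 * \<mu> * \<psi>) b + sc (2 * \<alpha>) (mult a1 e1)
      = sc ((\<theta> + \<beta>) * \<psi>) b + sc (\<theta> - \<beta>) e0"
    and "sc (2 * \<mu> * \<alpha>) e1 + sc (2 * \<alpha>\<^sup>2 * \<psi>) a1 + sc (2 * \<alpha>) (mult e0 a1)
        = sc (\<theta> + (2 * \<alpha> - 1) * \<beta>) e1"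
    using b.jordan_unique[OF *] by (simp_all add: jordan_mem)
qed

lemma ae_\<alpha>: "sc (\<mu> * \<alpha>) e1 + sc (\<psi> * \<alpha>) a1 + mult a0 e1 + mult e0 a1
    = sc \<beta> e1"
proof -
  have X: "mult (sc \<mu> b + a0 + a1) (sc \<psi> b + e0 + e1) = sc \<beta> (sc \<psi> b + e0 + e1)"
    using ae by (simp only: a_decomp[symmetric] e_decomp[symmetric])
  have *: "(sc (\<mu> * \<psi>) b + mult a0 e0 + mult a1 e1) + (sc (\<mu> * \<alpha>) e1 + sc (\<psi> * \<alpha>) a1 + mult a0 e1 + mult e0 a1)
      = (sc (\<beta> * \<psi>) b + sc \<beta> e0) + (sc \<beta> e1)"
    (is "?L = ?R")
  proof (rule vec_eqI)
    fix l :: "'a \<Rightarrow> 'f" assume l: "Vector_Spaces.linear sc (*) l"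
    note L = functional_simps[OF l] bilinear products mult_commute
    show "l ?L = l ?R"
      using arg_cong[OF X, of l] by (simp only: L) algebra
  qed
  show ?thesis
    using b.jordan_unique(2)[OF *] by (simp add: jordan_mem)
qed

lemma f_eq: "f = sc \<psi> b - e0 + sc (2 * \<alpha> - 1) e1"
proof -
  show ?thesis
  proof (rule vec_eqI)
    fix l :: "'a \<Rightarrow> 'f" assume l: "Vector_Spaces.linear sc (*) l"
    note L = functional_simps[OF l] bilinear products mult_commute
    show "l (f) = l (sc \<psi> b - e0 + sc (2 * \<alpha> - 1) e1)"
      using arg_cong[OF two_be, of l] arg_cong[OF be, of l] arg_cong[OF e_decomp, of l]
      by (simp only: L) algebra
  qed
qed

lemma ee_\<alpha>: "sc (2 * \<psi> * \<alpha>) e1 + sc 2 (mult e0 e1) = sc (2 * \<alpha> - 1) e1"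
proof -
  have X: "mult (sc \<psi> b + e0 + e1) (sc \<psi> b + e0 + e1)
      = sc \<psi> b - e0 + sc (2 * \<alpha> - 1) e1"
    using ee f_eq by (simp only: e_decomp[symmetric])
  have *: "(sc (\<psi>\<^sup>2) b + mult e0 e0 + mult e1 e1) + (sc (2 * \<psi> * \<alpha>) e1 + sc 2 (mult e0 e1))
      = (sc \<psi> b - e0) + (sc (2 * \<alpha> - 1) e1)"
    (is "?L = ?R")
  proof (rule vec_eqI)
    fix l :: "'a \<Rightarrow> 'f" assume l: "Vector_Spaces.linear sc (*) l"
    note L = functional_simps[OF l] bilinear products mult_commute
    show "l ?L = l ?R"
      using arg_cong[OF X, of l] by (simp only: L) algebra
  qed
  show ?thesis
    using b.jordan_unique(2)[OF *] by (simp add: jordan_mem)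
qed

text \<open>On the \<open>a\<close>-side \<open>2 e(be)\<close> is \<open>fe + ee\<close>, that is
  \<epsilon> times \<open>e\<close> plus \<open>f\<close>. Together with \<open>ee_\<alpha>\<close>
  this allows \<open>e0 e1\<close> to be eliminated.\<close>

lemma ebe_\<alpha>: "sc (2 * \<psi> * \<alpha> + 2 * \<psi> * \<alpha>\<^sup>2) e1 + sc (2 * \<alpha>) (mult e0 e1)
    = sc (\<epsilon> + 2 * \<alpha> - 1) e1"
proof -
  have X: "mult e (sc 2 (mult b e)) = mult e (f + e)" by (simp only: two_be)
  have Y: "mult e (mult b e) = mult (sc \<psi> b + e0 + e1) (sc \<psi> b + sc \<alpha> e1)"
    by (simp only: be e_decomp[symmetric])
  have *: "(sc (2 * \<psi>\<^sup>2) b + sc (2 * \<alpha>) (mult e1 e1)) + (sc (2 * \<psi> * \<alpha> + 2 * \<psi> * \<alpha>\<^sup>2) e1 + sc (2 * \<alpha>) (mult e0 e1))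
      = (sc ((\<epsilon> + 1) * \<psi>) b + sc (\<epsilon> - 1) e0) + (sc (\<epsilon> + 2 * \<alpha> - 1) e1)"
    (is "?L = ?R")
  proof (rule vec_eqI)
    fix l :: "'a \<Rightarrow> 'f" assume l: "Vector_Spaces.linear sc (*) l"
    note L = functional_simps[OF l] bilinear products mult_commute fe fe[THEN mult_swap]
    show "l ?L = l ?R"
      using arg_cong[OF X, of l] arg_cong[OF Y, of l] arg_cong[OF two_be, of l]
        arg_cong[OF be, of l] arg_cong[OF e_decomp, of l]
      by (simp only: L) algebra
  qed
  show ?thesis
    using b.jordan_unique(2)[OF *] by (simp add: jordan_mem)
qed

text \<open>The ratio of the \<alpha>-parts of \<open>e\<close> and \<open>a\<close> with respect to
  \<open>b\<close>. Its vanishing separates the two families of algebras.\<close>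

definition "k = (2 * \<alpha> * \<mu> + \<alpha> - 2 * \<alpha>\<^sup>2 - (1 - \<alpha>) * \<nu>) / (\<beta> * (\<beta> - \<alpha>))"

lemma k_eq: "k * (\<beta> * (\<beta> - \<alpha>))
    = 2 * \<alpha> * \<mu> + \<alpha> - 2 * \<alpha>\<^sup>2 - (1 - \<alpha>) * \<nu>"
  using \<beta>0 \<alpha>\<beta> by (simp add: k_def)

text \<open>Subtracting \<alpha> times \<open>aa_\<alpha>\<close> from \<open>aab_\<alpha>\<close>
  removes \<open>a0 a1\<close> and leaves a relation between \<open>e1\<close> and \<open>a1\<close>
  alone.\<close>

lemma e1_eq: "e1 = sc k a1"
proof -
  note X = arg_cong[OF aa_\<alpha>, of "sc \<alpha>"]
  have "sc (\<beta> * (\<beta> - \<alpha>)) e1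
      = sc (2 * \<alpha> * \<mu> + \<alpha> - 2 * \<alpha>\<^sup>2 - (1 - \<alpha>) * \<nu>) a1"
    (is "?L = ?R")
  proof (rule vec_eqI)
    fix l :: "'a \<Rightarrow> 'f" assume l: "Vector_Spaces.linear sc (*) l"
    note L = functional_simps[OF l] bilinear products mult_commute
    show "l ?L = l ?R"
      using arg_cong[OF X, of l] arg_cong[OF aab_\<alpha>, of l] by (simp only: L) algebra
  qed
  then have "sc (\<beta> * (\<beta> - \<alpha>)) e1 = sc (\<beta> * (\<beta> - \<alpha>)) (sc k a1)"
    unfolding k_eq[symmetric] by (simp only: scale_scale mult.commute)
  from scale_left_imp_eq[OF _ this] show ?thesis using \<beta>0 \<alpha>\<beta> by simp
qed

section \<open>The \<open>b\<close>-components in terms of \<open>a\<close>, \<open>p\<close>,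
  \<open>q\<close>, \<open>e\<close>, \<open>f\<close>, and the resulting scalar relations\<close>

lemma two_a1: "sc (2 * \<alpha>) a1 = q + sc \<beta> e - sc \<mu> (p + e)"
proof -
  show ?thesis
  proof (rule vec_eqI)
    fix l :: "'a \<Rightarrow> 'f" assume l: "Vector_Spaces.linear sc (*) l"
    note L = functional_simps[OF l] bilinear products mult_commute
    show "l (sc (2 * \<alpha>) a1) = l (q + sc \<beta> e - sc \<mu> (p + e))"
      using arg_cong[OF two_ab, of l] arg_cong[OF ab, of l] arg_cong[OF two_b, of l]
      by (simp only: L) algebra
  qed
qed

lemma two_e1: "sc (2 * \<alpha>) e1 = f + e - sc \<psi> (p + e)"
proof -
  show ?thesis
  proof (rule vec_eqI)
    fix l :: "'a \<Rightarrow> 'f" assume l: "Vector_Spaces.linear sc (*) l"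
    note L = functional_simps[OF l] bilinear products mult_commute
    show "l (sc (2 * \<alpha>) e1) = l (f + e - sc \<psi> (p + e))"
      using arg_cong[OF two_be, of l] arg_cong[OF be, of l] arg_cong[OF two_b, of l]
      by (simp only: L) algebra
  qed
qed

lemma two_a0: "sc (2 * \<alpha>) a0
    = sc (2 * \<alpha>) a - sc (\<alpha> * \<mu>) (p + e) - (q + sc \<beta> e - sc \<mu> (p + e))"
proof -
  show ?thesis
  proof (rule vec_eqI)
    fix l :: "'a \<Rightarrow> 'f" assume l: "Vector_Spaces.linear sc (*) l"
    note L = functional_simps[OF l] bilinear products mult_commute
    show "l (sc (2 * \<alpha>) a0)
        = l (sc (2 * \<alpha>) a - sc (\<alpha> * \<mu>) (p + e) - (q + sc \<beta> e - sc \<mu> (p + e)))"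
      using arg_cong[OF two_a1, of l] arg_cong[OF a_decomp, of l] arg_cong[OF two_b, of l]
      by (simp only: L) algebra
  qed
qed

lemma two_e0: "sc (2 * \<alpha>) e0
    = sc (2 * \<alpha>) e - sc (\<alpha> * \<psi>) (p + e) - sc k (q + sc \<beta> e - sc \<mu> (p + e))"
proof -
  have X: "sc (2 * \<alpha>) e1 = sc k (q + sc \<beta> e - sc \<mu> (p + e))"
    unfolding two_a1[symmetric] e1_eq by (simp add: ac_simps)
  show ?thesis
  proof (rule vec_eqI)
    fix l :: "'a \<Rightarrow> 'f" assume l: "Vector_Spaces.linear sc (*) l"
    note L = functional_simps[OF l] bilinear products mult_commute
    show "l (sc (2 * \<alpha>) e0)
        = l (sc (2 * \<alpha>) e - sc (\<alpha> * \<psi>) (p + e) - sc k (q + sc \<beta> e - sc \<mu> (p + e)))"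
      using arg_cong[OF X, of l] arg_cong[OF e_decomp, of l] arg_cong[OF two_b, of l]
      by (simp only: L) algebra
  qed
qed

text \<open>These are the even and odd parts, with respect to \<open>a\<close>, of
  \<open>e1_eq\<close> after substitution of \<open>two_a1\<close> and
  \<open>two_e1\<close>.\<close>

lemma f_dependent: "f = sc \<psi> p + sc k (q - sc \<mu> p)"
  and k_psi: "1 - \<psi> = k * (\<beta> - \<mu>)"
proof -
  have *: "(f - sc \<psi> p) + sc (1 - \<psi>) e
      = sc k (q - sc \<mu> p) + sc (k * (\<beta> - \<mu>)) e"
    (is "?L = ?R")
  proof (rule vec_eqI)
    fix l :: "'a \<Rightarrow> 'f" assume l: "Vector_Spaces.linear sc (*) l"
    note L = functional_simps[OF l] bilinear products mult_commute
    show "l ?L = l ?R"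
      using arg_cong[OF two_a1, of l] arg_cong[OF two_e1, of l] arg_cong[OF e1_eq, of l]
      by (simp only: L) algebra
  qed
  have "f - sc \<psi> p = sc k (q - sc \<mu> p)" "sc (1 - \<psi>) e = sc (k * (\<beta> - \<mu>)) e"
    using parity_unique[OF *] by (simp_all add: parity_mem)
  then show "f = sc \<psi> p + sc k (q - sc \<mu> p)" "1 - \<psi> = k * (\<beta> - \<mu>)"
    using e_neq_0 by (simp_all add: diff_eq_eq add.commute)
qed

lemma q_scalar: "\<theta> = t" if "mult q e = sc t e"
  using qe that e_neq_0 by simp

lemma p_neq_0: "p \<noteq> 0"
  using pe e_neq_0 by auto

lemma a_neq_0: "a \<noteq> 0"
  using ae e_neq_0 \<beta>0 by auto

text \<open>If \<open>a1\<close> vanished, parity would force \<mu> = \<beta> and \<open>ap\<close>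
  to be \<beta> times \<open>p\<close>. Then \<open>p\<close> would be even and odd, hence zero,
  against \<open>pe\<close>.\<close>

lemma a1_neq_0: "a1 \<noteq> 0"
proof
  assume "a1 = 0"
  then have *: "q + sc \<beta> e = sc \<mu> p + sc \<mu> e" using two_a1 by (simp add: scale_right_distrib)
  have "q = sc \<mu> p" "sc \<beta> e = sc \<mu> e"
    using parity_unique[OF *] by (simp_all add: parity_mem)
  then have "mult a p = sc \<beta> p" using e_neq_0 by (simp add: ap)
  then have "p \<in> Odd" by (simp add: mem_eigenspace)
  then have "p = 0" using parity_unique(1)[of p 0 0 p] by (simp add: parity_mem)
  then show False using p_neq_0 by simp
qed

text \<open>Eliminating \<open>a1 a1\<close> between \<open>aa_01\<close> and \<open>aab_01\<close>
  leaves only multiples of \<open>b\<close> and 0-eigenvectors of \<open>b\<close>, so the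
  coefficients of \<open>b\<close> agree.\<close>

lemma b_coefficient_relation: "2 * (1 - \<alpha>) * \<mu>\<^sup>2
    = (1 - \<alpha>) * \<nu> * \<mu> + \<beta> * (\<beta> - \<alpha>) * \<psi>"
proof -
  have *: "sc (2 * \<alpha> * \<mu>\<^sup>2 + (1 - \<alpha>) * \<nu> * \<mu> + \<beta> * (\<beta> - \<alpha>) * \<psi>) b + (sc (2 * \<alpha>) (mult a0 a0) + sc ((1 - \<alpha>) * \<nu> - 2 * \<alpha>) a0 + sc (\<beta> * (\<beta> - \<alpha>)) e0)
      = sc (2 * \<mu>\<^sup>2) b + 0"
    (is "?L = ?R")
  proof (rule vec_eqI)
    fix l :: "'a \<Rightarrow> 'f" assume l: "Vector_Spaces.linear sc (*) l"
    note L = functional_simps[OF l] bilinear products mult_commute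
    show "l ?L = l ?R"
      using arg_cong[OF aa_01, of l] arg_cong[OF aab_01, of l] by (simp only: L) algebra
  qed
  from b_coefficient(1)[OF *] have "2 * \<alpha> * \<mu>\<^sup>2 + (1 - \<alpha>) * \<nu> * \<mu> + \<beta> * (\<beta> - \<alpha>) * \<psi> = 2 * \<mu>\<^sup>2"
    using a0 e0 b.fusion_00 by (simp add: closed)
  then show ?thesis by algebra
qed

lemma e1_relation: "e1 \<noteq> 0 \<Longrightarrow> (2 * \<alpha> - 1) * (2 * \<psi> + \<alpha> - 2)
    = 0"
proof -
  assume "e1 \<noteq> 0"
  moreover have "sc ((2 * \<alpha> - 1) * (2 * \<psi> + \<alpha> - 2)) e1 = 0"
    (is "?L = ?R")
  proof (rule vec_eqI)
    fix l :: "'a \<Rightarrow> 'f" assume l: "Vector_Spaces.linear sc (*) l"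
    note L = functional_simps[OF l] bilinear products mult_commute \<epsilon>_def
    show "l ?L = l ?R"
      using arg_cong[OF ee_\<alpha>, of l] arg_cong[OF ebe_\<alpha>, of l] by (simp only: L) algebra
  qed
  ultimately show ?thesis by simp
qed

text \<open>Obtained by eliminating \<open>e0 a1\<close> between \<open>ae_\<alpha>\<close> and
  \<open>eab_\<alpha>\<close>.\<close>

lemma al_a0e1: "sc \<alpha> (mult a0 e1)
    = sc ((1 - \<alpha>) * (\<beta> - (1 - \<alpha>) * \<mu>)) e1"
proof -
  have "sc 2 (sc \<alpha> (mult a0 e1))
      = sc 2 (sc ((1 - \<alpha>) * (\<beta> - (1 - \<alpha>) * \<mu>)) e1)"
    (is "?L = ?R")
  proof (rule vec_eqI)
    fix l :: "'a \<Rightarrow> 'f" assume l: "Vector_Spaces.linear sc (*) l"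
    note L = functional_simps[OF l] bilinear products mult_commute \<theta>_def
    show "l ?L = l ?R"
      using arg_cong[OF ae_\<alpha>, of l] arg_cong[OF eab_\<alpha>, of l] by (simp only: L) algebra
  qed
  then show ?thesis using two by (simp only: scale_cancel_left) simp
qed

text \<open>The product \<open>a0 e1\<close> is known from \<open>al_a0e1\<close>, and also as
  \<open>k\<close> times \<open>a0 a1\<close> from \<open>aa_\<alpha>\<close>. Since
  \<open>k\<close> and \<open>a1\<close> are nonzero, the coefficients can be compared.\<close>

lemma mu_relation:
  assumes "k \<noteq> 0"
  shows "(4 * \<alpha> - 2) * \<mu> = \<alpha> - 2 * (1 - \<alpha>) * \<beta>"
proof -
  have X: "mult a0 e1 = sc k (mult a0 a1)" by (simp add: e1_eq bilinear)
  have "sc k (sc ((4 * \<alpha> - 2) * \<mu>) a1)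
      = sc k (sc (\<alpha> - 2 * (1 - \<alpha>) * \<beta>) a1)"
    (is "?L = ?R")
  proof (rule vec_eqI)
    fix l :: "'a \<Rightarrow> 'f" assume l: "Vector_Spaces.linear sc (*) l"
    note L = functional_simps[OF l] bilinear products mult_commute
    show "l ?L = l ?R"
      using arg_cong[OF X, of l] arg_cong[OF aa_\<alpha>, of l] arg_cong[OF al_a0e1, of l]
        arg_cong[OF e1_eq, of l]
      by (simp only: L) algebra
  qed
  then show ?thesis using assms a1_neq_0 by simp
qed

text \<open>Since \<open>a1 e1\<close> is \<open>k\<close> times \<open>a1 a1\<close>, the relations
  \<open>eab_01\<close> and \<open>aab_01\<close> can be combined. The 0-parts give the claim after
  \<open>mu_relation\<close> exposes a common factor 1 - \<alpha>.\<close>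

lemma e0_relation:
  assumes "k \<noteq> 0"
  shows "sc (\<nu> - 2 * \<alpha>) e0 = sc (k * \<nu>) a0"
proof -
  have X: "mult a1 e1 = sc k (mult a1 a1)" by (simp add: e1_eq bilinear)
  have *: "sc ((\<theta> + \<beta>) * \<psi> - 2 * \<mu> * \<psi>) b + sc (\<theta> - \<beta> - k * (\<beta> * (\<beta> - \<alpha>))) e0
      = sc (k * (2 * \<alpha> * \<mu> + (1 - \<alpha>) * \<nu> * \<mu> + \<beta> * (\<beta> - \<alpha>) * \<psi> - 2 * \<mu>\<^sup>2)) b + sc (k * (1 - \<alpha>) * \<nu>) a0"
    (is "?L = ?R")
  proof (rule vec_eqI)
    fix l :: "'a \<Rightarrow> 'f" assume l: "Vector_Spaces.linear sc (*) l"
    note L = functional_simps[OF l] bilinear products mult_commute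
    show "l ?L = l ?R"
      using arg_cong[OF X, of l] arg_cong[OF eab_01, of l] arg_cong[OF aab_01, of l]
      by (simp only: L) algebra
  qed
  have "sc (\<theta> - \<beta> - k * (\<beta> * (\<beta> - \<alpha>))) e0
      = sc (k * (1 - \<alpha>) * \<nu>) a0"
    using b_coefficient(2)[OF *] e0 a0 by (simp add: closed)
  moreover have "\<theta> - \<beta> - k * (\<beta> * (\<beta> - \<alpha>))
      = (1 - \<alpha>) * (\<nu> - 2 * \<alpha>)"
    unfolding k_eq \<theta>_def using mu_relation[OF assms] by algebra
  ultimately have "sc (1 - \<alpha>) (sc (\<nu> - 2 * \<alpha>) e0)
      = sc (1 - \<alpha>) (sc (k * \<nu>) a0)"
    by (simp add: ac_simps)
  from scale_left_imp_eq[OF _ this] show ?thesis using \<alpha>1 by simp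
qed

text \<open>Substituting \<open>two_a0\<close> and \<open>two_e0\<close> into
  \<open>e0_relation\<close> produces a relation among \<open>a\<close>, \<open>p\<close>,
  \<open>q\<close>, \<open>e\<close> whose even part can be solved for \<open>q\<close>. The scalar
  \<open>s\<close> comes from the coefficients of \<open>p\<close>, and \<open>t\<close> from those
  of \<open>e\<close>.\<close>

lemma q_dependent:
  assumes "k \<noteq> 0"
  obtains r where "q = sc \<nu> a + sc r p"
proof -
  define s where "s = \<psi> * (\<nu> - 2 * \<alpha>) + k * \<mu> * (2 - \<nu>)"
  define t where "t = (\<nu> - 2 * \<alpha>) * (2 * \<alpha> - \<alpha> * \<psi> - k * (\<beta> - \<mu>)) - k * \<nu> * (\<mu> - \<alpha> * \<mu> - \<beta>)"
  have *: "sc \<alpha> (sc (2 * k) q) + sc t e = sc \<alpha> (sc (2 * k * \<nu>) a + sc s p) + 0"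
    (is "?L = ?R")
  proof (rule vec_eqI)
    fix l :: "'a \<Rightarrow> 'f" assume l: "Vector_Spaces.linear sc (*) l"
    note L = functional_simps[OF l] bilinear products mult_commute s_def t_def
    show "l ?L = l ?R"
      using arg_cong[OF e0_relation[OF assms], of l] arg_cong[OF two_a0, of l]
        arg_cong[OF two_e0, of l]
      by (simp only: L) algebra
  qed
  have "sc \<alpha> (sc (2 * k) q) = sc \<alpha> (sc (2 * k * \<nu>) a + sc s p)"
    using parity_unique(1)[OF *] by (simp add: parity_mem)
  then have "sc (2 * k) q = sc (2 * k * \<nu>) a + sc s p" using \<alpha>0 by (simp only: scale_cancel_left) auto
  then have "sc (2 * k) q = sc (2 * k) (sc \<nu> a + sc (s / (2 * k)) p)"
    using two assms by (simp add: scale_right_distrib)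
  then have "q = sc \<nu> a + sc (s / (2 * k)) p" using two assms by simp
  then show ?thesis by (rule that)
qed

lemma two_cancel: "2 * x = 0 \<Longrightarrow> x = (0 :: 'f)"
  using two by simp

lemma scale_p_eqD: "sc s p = sc t p \<Longrightarrow> s = t"
  using p_neq_0 by simp

lemma scale_e_eqD: "sc s e = sc t e \<Longrightarrow> s = t"
  using e_neq_0 by simp

section \<open>The two cases\<close>

text \<open>If \<open>p\<close> were a multiple of \<open>a\<close>, then \<open>q = p\<close>, and
  the product formulas would become equations in the scalars alone. With \<open>mu_relation\<close>
  these give 1 - \<beta> = 1 - \<alpha>.\<close>

lemma p_not_multiple:
  assumes "k \<noteq> 0"
  shows "p \<noteq> sc x a"
proof
  assume "p = sc x a"
  then have qp: "q = p" using ap by (simp add: bilinear idem)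
  have X: "p = sc \<alpha> p + sc ((1 - \<alpha>) * \<nu>) a" using aq by (simp add: qp ap)
  have "sc (1 - \<alpha>) p = sc (1 - \<alpha>) (sc \<nu> a)"
    (is "?L = ?R")
  proof (rule vec_eqI)
    fix l :: "'a \<Rightarrow> 'f" assume l: "Vector_Spaces.linear sc (*) l"
    note L = functional_simps[OF l] bilinear products mult_commute
    show "l ?L = l ?R"
      using arg_cong[OF X, of l] by (simp only: L) algebra
  qed
  then have p: "p = sc \<nu> a" using \<alpha>1 by (simp only: scale_cancel_left) simp
  have "mult (sc \<nu> a) e = e" using pe unfolding p[symmetric] .
  then have "sc (\<nu> * \<beta>) e = sc 1 e" by (simp add: bilinear ae)
  then have h1: "\<nu> * \<beta> = 1" by (rule scale_e_eqD)
  have h2: "2 * \<alpha> * \<beta> - \<beta> + 2 * (1 - \<alpha>) * \<mu> = 1"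
    using q_scalar[of 1] qp pe by (simp add: \<theta>_def)
  have "mult p p = mult (sc \<nu> a) p" using p by simp
  then have Y: "mult p p = sc \<nu> p" by (simp add: bilinear ap qp)
  have "sc \<nu> p = sc (2 * \<alpha> - \<beta> * (2 - \<nu>) + 2 * (1 - \<alpha>) * \<mu>) p"
    (is "?L = ?R")
  proof (rule vec_eqI)
    fix l :: "'a \<Rightarrow> 'f" assume l: "Vector_Spaces.linear sc (*) l"
    show "l ?L = l ?R"
      using arg_cong[OF pq[unfolded qp Y], of l] arg_cong[OF pp[unfolded Y], of l]
      unfolding functional_simps[OF l] by algebra
  qed
  then have h3: "\<nu> = 2 * \<alpha> - \<beta> * (2 - \<nu>) + 2 * (1 - \<alpha>) * \<mu>" by (rule scale_p_eqD)
  have h4: "\<nu> = 2 * \<alpha> - \<beta> + 2 - 2 * \<alpha> * \<beta>" using h1 h2 h3 by algebra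
  have "(1 - \<beta>) * (1 - \<beta> - 2 * \<alpha> * \<beta>) = 0" using h1 h4 by algebra
  then have h5: "1 - \<beta> = 2 * \<alpha> * \<beta>" using \<beta>1 by simp
  have "2 * ((1 - \<alpha>) * \<mu>) = 2 * \<beta>" using h2 h5 by algebra
  then have h6: "(1 - \<alpha>) * \<mu> = \<beta>" using two by simp
  have "\<alpha> * (2 * \<alpha> * \<beta> - (1 - \<alpha>)) = 0"
    using mu_relation[OF assms] h6 by algebra
  then have "2 * \<alpha> * \<beta> = 1 - \<alpha>" using \<alpha>0 by simp
  then show False using h5 \<alpha>\<beta> by simp
qed

lemma a_p_coefficients:
  assumes "sc s a + sc t p = sc s' a + sc t' p" "\<And>x. p \<noteq> sc x a"
  shows "s = s'" "t = t'"
proof -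
  show "t = t'"
  proof (rule ccontr)
    assume "t \<noteq> t'"
    have "sc (t - t') p = sc (s' - s) a"
      using assms(1) by (simp add: scale_left_diff_distrib algebra_simps)
    then have "sc (inverse (t - t')) (sc (t - t') p) = sc (inverse (t - t')) (sc (s' - s) a)"
      by simp
    then have "p = sc (inverse (t - t') * (s' - s)) a" using \<open>t \<noteq> t'\<close> by simp
    then show False using assms(2) by blast
  qed
  then show "s = s'" using assms(1) a_neq_0 by simp
qed

text \<open>Here \<open>p\<close> would be an \<alpha>-eigenvector of \<open>a\<close> and
  \<open>pp\<close> a multiple of \<open>p\<close>; as fusion puts \<open>pp\<close> into the sum
  for 0 and 1, it vanishes. Then 2\<alpha> = -1, 2\<beta> = -7, 2\<mu> = -5, 4\<psi> = 5 and
  4\<open>k\<close> = 1, and the relation \<open>z = 0\<close> turns into 1 = 0.\<close>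

lemma q_neq_scale_p:
  assumes "k \<noteq> 0" "q = sc \<alpha> p"
  shows False
proof -
  have \<nu>: "\<nu> = 0"
  proof -
    have X: "mult a (sc \<alpha> p) = sc \<alpha> (sc \<alpha> p) + sc ((1 - \<alpha>) * \<nu>) a" using aq by (simp only: assms(2))
    then have "sc ((1 - \<alpha>) * \<nu>) a = 0" by (simp add: bilinear ap assms(2))
    then show ?thesis using a_neq_0 \<alpha>1 by simp
  qed
  define z where "z = 2 - \<psi> - k * \<alpha> + k * \<mu>"
  have pz: "mult p p = sc z p"
  proof (rule vec_eqI)
    fix l :: "'a \<Rightarrow> 'f" assume l: "Vector_Spaces.linear sc (*) l"
    show "l (mult p p) = l (sc z p)"
      using arg_cong[OF f_dependent[unfolded assms(2)], of l] arg_cong[OF pp, of l]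
      unfolding functional_simps[OF l] z_def by algebra
  qed
  have p_mem: "p \<in> eigenspace a \<alpha>" using assms(2) ap by (simp add: mem_eigenspace)
  have "mult p p \<in> eigensum a {0, 1}" "sc z p \<in> eigenspace a \<alpha>"
    using fusion_\<alpha>\<alpha>[OF p_mem p_mem] p_mem by (simp_all add: closed)
  then have "mult p p = 0" using eigensum_eigenspace_Int[of "{0, 1}" \<alpha> "sc z p" a] \<alpha>0 \<alpha>1 pz by simp
  then have z0: "z = 0" and f: "f = sc 2 p" using pz pp p_neq_0 by simp_all
  have "mult p q = 0" using \<open>mult p p = 0\<close> by (simp add: assms(2) bilinear)
  have "sc (2 * \<alpha>\<^sup>2 - 2 * \<beta> + 2 * (1 - \<alpha>) * \<mu>) p = sc 0 p"
    (is "?L = ?R")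
  proof (rule vec_eqI)
    fix l :: "'a \<Rightarrow> 'f" assume l: "Vector_Spaces.linear sc (*) l"
    show "l ?L = l ?R"
      using arg_cong[OF pq[unfolded \<open>mult p q = 0\<close> f], of l]
        arg_cong[OF assms(2), of l]
      unfolding functional_simps[OF l] by algebra
  qed
  then have h1: "2 * \<alpha>\<^sup>2 - 2 * \<beta> + 2 * (1 - \<alpha>) * \<mu> = 0" by (rule scale_p_eqD)
  have h2: "2 * \<alpha> * \<beta> - \<beta> + 2 * (1 - \<alpha>) * \<mu> = \<alpha>"
    using q_scalar[of \<alpha>] by (simp add: assms(2) bilinear pe \<theta>_def)
  have "(1 + 2 * \<alpha>) * (\<alpha> - \<beta>) = 0" using h1 h2 by algebra
  then have h3: "2 * \<alpha> = - 1" using \<alpha>\<beta> by (simp add: add_eq_0_iff)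
  have e1: "e1 \<noteq> 0" using e1_eq a1_neq_0 assms(1) by simp
  have "2 * (4 * \<psi> - 5) = 0" using e1_relation[OF e1] h3 by algebra
  then have "4 * \<psi> - 5 = 0" using two by (metis mult_eq_0_iff)
  then have h4: "4 * \<psi> = 5" by algebra
  have S: "8 * \<mu> = 1 + 6 * \<beta>" using mu_relation[OF assms(1)] h3 by algebra
  have "2 * (2 * \<beta> + 7) = 0" using S h1 h3 by algebra
  then have "2 * \<beta> + 7 = 0" by (rule two_cancel)
  then have h5: "2 * \<beta> = - 7" by algebra
  have "2 * (2 * (2 * \<mu> + 5)) = 0" using S h5 by algebra
  then have "2 * \<mu> + 5 = 0" by (rule two_cancel[OF two_cancel])
  then have h6: "2 * \<mu> = - 5" by algebra
  have h7: "\<beta> - \<mu> = - 1"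
  proof -
    have "2 * (\<beta> - \<mu> + 1) = 0" using h5 h6 by algebra
    then have "\<beta> - \<mu> + 1 = 0" by (rule two_cancel)
    then show ?thesis by algebra
  qed
  have h8: "4 * k = 1" using k_psi h4 h7 by algebra
  have h9: "\<alpha> - \<mu> = 2"
  proof -
    have "2 * (\<alpha> - \<mu> - 2) = 0" using h3 h6 by algebra
    then have "\<alpha> - \<mu> - 2 = 0" by (rule two_cancel)
    then show ?thesis by algebra
  qed
  have "2 - \<psi> - k * (\<alpha> - \<mu>) = 0" using z0 by (simp add: z_def algebra_simps)
  then have "4 * 2 - 4 * \<psi> - (4 * k) * (\<alpha> - \<mu>) = 0" by algebra
  then have "(1::'f) = 0" unfolding h4 h8 h9 by simp
  then show False by simp
qed

lemma dependent_case:
  assumes "k \<noteq> 0"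
  shows "\<alpha> + \<beta> = 1" "q = sc (\<alpha> + 1) a" "f = sc (2 - \<alpha>) p - sc (\<alpha> + 1) a"
proof -
  have indep: "p \<noteq> sc x a" for x using p_not_multiple[OF assms] .
  obtain r where q: "q = sc \<nu> a + sc r p" by (rule q_dependent[OF assms])
  have X: "mult a (sc \<nu> a + sc r p)
      = sc \<alpha> (sc \<nu> a + sc r p) + sc ((1 - \<alpha>) * \<nu>) a"
    using aq by (simp only: q[symmetric])
  \<comment> \<open>Comparing \<open>aq\<close> with the product computed from the new expression
    for \<open>q\<close> leaves only \<open>r = 0\<close> and \<open>r = \<alpha>\<close>; the
    latter also forces \<nu> = 0 and is excluded by \<open>q_neq_scale_p\<close>.\<close>
  have *: "sc (r * \<nu>) a + sc (r * (r - \<alpha>)) p = sc 0 a + sc 0 p"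
    (is "?L = ?R")
  proof (rule vec_eqI)
    fix l :: "'a \<Rightarrow> 'f" assume l: "Vector_Spaces.linear sc (*) l"
    note L = functional_simps[OF l] bilinear products mult_commute
    show "l ?L = l ?R"
      using arg_cong[OF X, of l] arg_cong[OF q, of l] by (simp only: L) algebra
  qed
  have r: "r * \<nu> = 0" "r * (r - \<alpha>) = 0" using a_p_coefficients[OF * indep] by simp_all
  have "r = 0"
  proof (rule ccontr)
    assume "r \<noteq> 0"
    then have "\<nu> = 0" "r = \<alpha>" using r by simp_all
    then show False using q_neq_scale_p[OF assms] q by simp
  qed
  then have q: "q = sc \<nu> a" using q by simp
  have Y: "mult p q = sc \<nu> (sc \<nu> a)" by (simp only: q bilinear ap mult_commute[of p])
  have *: "sc (\<nu>\<^sup>2) a + sc 0 p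
      = sc (2 * \<alpha> * \<nu> - \<beta> * k * \<nu>) a + sc (2 * (1 - \<alpha>) * \<mu> - \<beta> * (\<psi> - k * \<mu>)) p"
    (is "?L = ?R")
  proof (rule vec_eqI)
    fix l :: "'a \<Rightarrow> 'f" assume l: "Vector_Spaces.linear sc (*) l"
    note L = functional_simps[OF l] bilinear products mult_commute
    show "l ?L = l ?R"
      using arg_cong[OF f_dependent, of l] arg_cong[OF Y[unfolded pq], of l] arg_cong[OF q, of l]
      by (simp only: L) algebra
  qed
  have h1: "\<nu>\<^sup>2 = 2 * \<alpha> * \<nu> - \<beta> * k * \<nu>" "0 = 2 * (1 - \<alpha>) * \<mu> - \<beta> * (\<psi> - k * \<mu>)"
    using a_p_coefficients[OF * indep] by simp_all
  have h2: "2 * \<alpha> * \<beta> - \<beta> + 2 * (1 - \<alpha>) * \<mu> = \<nu> * \<beta>"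
    using q_scalar[of "\<nu> * \<beta>"] by (simp add: q bilinear ae \<theta>_def)
  have h3: "\<psi> - k * \<mu> = 1 - k * \<beta>" using k_psi by algebra
  have "\<beta> * (k * \<beta> - 2 * \<alpha> + \<nu>) = 0" using h1(2) h2 h3 by algebra
  then have "k * \<beta> - 2 * \<alpha> + \<nu> = 0" using \<beta>0 by simp
  then have h4: "k * \<beta> = 2 * \<alpha> - \<nu>" by algebra
  \<comment> \<open>Now \<open>p\<close> has no \<alpha>-part and \<open>x\<close> is its 0-part.
    That \<open>xx\<close> is again a 0-eigenvector supplies the missing equation
    \<open>h5\<close>.\<close>
  define x where "x = p - sc \<nu> a"
  have x: "x \<in> eigenspace a 0"
    by (simp add: x_def mem_eigenspace bilinear ap q idem)
  have x0: "mult a (mult x x) = 0" using fusion_00[OF x x] by (simp add: mem_eigenspace)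
  have Z: "mult x x = sc (1 + k * \<beta>) p - sc (k * \<nu> + \<nu>\<^sup>2) a"
    (is "?L = ?R")
  proof (rule vec_eqI)
    fix l :: "'a \<Rightarrow> 'f" assume l: "Vector_Spaces.linear sc (*) l"
    note L = functional_simps[OF l] bilinear products mult_commute x_def
    show "l ?L = l ?R"
      using arg_cong[OF f_dependent, of l] arg_cong[OF q, of l]
        arg_cong[OF pp, of l] k_psi by (simp only: L) algebra
  qed
  have "sc (\<nu> * (1 + k * \<beta> - k - \<nu>)) a = sc 0 a"
    (is "?L = ?R")
  proof (rule vec_eqI)
    fix l :: "'a \<Rightarrow> 'f" assume l: "Vector_Spaces.linear sc (*) l"
    note L = functional_simps[OF l] bilinear products mult_commute
    show "l ?L = l ?R"
      using arg_cong[OF x0[unfolded Z], of l] arg_cong[OF q, of l] by (simp only: L) algebra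
  qed
  then have h5: "\<nu> * (1 + k * \<beta> - k - \<nu>) = 0" using a_neq_0 by simp
  have "\<alpha> + \<beta> = 1 \<and> \<nu> = \<alpha> + 1"
  proof (cases "\<nu> = 0")
    \<comment> \<open>This branch leads to \<alpha> = -1 and \<beta> = 2, so that \<nu> = \<alpha> +
      1 holds here as well.\<close>
    case True
    have "2 * \<alpha> * (2 * \<beta> - 2 * \<mu> - 1) = 0" using k_eq h4 True by algebra
    then have "2 * \<beta> - 2 * \<mu> - 1 = 0" using two \<alpha>0 by simp
    then have m: "2 * \<beta> - 1 = 2 * \<mu>" by algebra
    have s: "\<alpha> + \<beta> = 1" using h2 True m by algebra
    have "(2 * \<alpha> - 1) * (\<alpha> + 1) = 0" using mu_relation[OF assms] m s by algebra
    moreover have "2 * \<alpha> - 1 \<noteq> 0"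
    proof
      assume "2 * \<alpha> - 1 = 0"
      then have "\<alpha> - \<beta> = 0" using s by algebra
      then show False using \<alpha>\<beta> by simp
    qed
    ultimately show ?thesis using s True by simp
  next
    case False
    then have "1 + k * \<beta> - k - \<nu> = 0" using h5 by simp
    then have h6: "k = 1 + 2 * \<alpha> - 2 * \<nu>" using h4 by algebra
    have h7: "\<nu> * (1 - 2 * \<beta>) = 2 * \<alpha> - \<beta> - 2 * \<alpha> * \<beta>" using h4 h6 by algebra
    have h8: "(2 * \<alpha> - 1) * \<beta> * (\<nu> - 2 * \<alpha> + 1)
        = \<alpha> * (1 - \<alpha>) - 2 * (1 - \<alpha>)\<^sup>2 * \<beta>"
      using mu_relation[OF assms] h2 by algebra
    have "(\<alpha> - \<beta>) * (\<alpha> + \<beta> - 1) = 0" using h7 h8 by algebra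
    then have s: "\<alpha> + \<beta> = 1" using \<alpha>\<beta> by simp
    have "(2 * \<alpha> - 1) * (\<nu> - \<alpha> - 1) = 0" using h7 s by algebra
    moreover have "2 * \<alpha> - 1 \<noteq> 0"
    proof
      assume "2 * \<alpha> - 1 = 0"
      then have "\<alpha> - \<beta> = 0" using s by algebra
      then show False using \<alpha>\<beta> by simp
    qed
    ultimately have "\<nu> - \<alpha> - 1 = 0" by (metis mult_eq_0_iff)
    then have "\<nu> = \<alpha> + 1" by algebra
    then show ?thesis using s by simp
  qed
  then show s: "\<alpha> + \<beta> = 1" and "q = sc (\<alpha> + 1) a" using q by simp_all
  have \<nu>: "\<nu> = \<alpha> + 1" using \<open>\<alpha> + \<beta> = 1 \<and> \<nu> = \<alpha> + 1\<close> by blast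
  have "\<beta> * (k + 1) = 0" using h4 \<nu> s by algebra
  then have "k + 1 = 0" using \<beta>0 by (metis mult_eq_0_iff)
  then have k: "k = - 1" by algebra
  have "\<psi> + \<mu> = 2 - \<alpha>" using h3 k s by algebra
  moreover have "f = sc (\<psi> + \<mu>) p - sc \<nu> a"
    (is "?L = ?R")
  proof (rule vec_eqI)
    fix l :: "'a \<Rightarrow> 'f" assume l: "Vector_Spaces.linear sc (*) l"
    show "l ?L = l ?R"
      using arg_cong[OF f_dependent[unfolded k q], of l]
      unfolding functional_simps[OF l] by algebra
  qed
  ultimately show "f = sc (2 - \<alpha>) p - sc (\<alpha> + 1) a" by (simp only: \<nu>)
qed

text \<open>With \<open>k = 0\<close> one gets \<open>ee = pp = p\<close>, so \<open>b\<close> and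
  \<open>c\<close> are orthogonal. The \<open>b\<close>-components give \<open>h2\<close> and
  \<open>h3\<close>, the \<open>a\<close>-components of \<open>p\<close> give \<open>h4\<close>, and
  elimination leaves 2\<alpha>(3\<alpha> - 1) = 0.\<close>

lemma orthogonal_case:
  assumes "k = 0"
  shows "f = p" "3 * \<alpha> = 1" "\<beta> = 2 * \<alpha>" "6 * \<nu> = 5" "p0 \<noteq> 0" "p1 \<noteq> 0"
    "sc 27 (mult q q) = sc 10 a + sc 9 q + sc 2 p" "\<mu> = \<beta>" "\<theta> = \<beta>"
proof -
  have \<psi>: "\<psi> = 1" using k_psi assms by simp
  then show f: "f = p" using f_dependent assms by simp
  have e1: "e1 = 0" using e1_eq assms by simp
  have "sc (2 * \<mu>) b + 0 = sc (\<theta> + \<beta>) b + sc (\<theta> - \<beta>) e0"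
    using eab_01 by (simp add: \<psi> e1)
  then have h1: "2 * \<mu> = \<theta> + \<beta>" "0 = sc (\<theta> - \<beta>) e0"
    using b_coefficient[of "2 * \<mu>" 0 "\<theta> + \<beta>" "sc (\<theta> - \<beta>) e0"] e0 by (simp_all add: closed)
  \<comment> \<open>Otherwise \<open>e = b\<close>, and \<open>two_b\<close> would make
    \<open>p\<close> equal to \<open>e\<close>, hence both even and odd.\<close>
  have "e0 \<noteq> 0"
  proof
    assume "e0 = 0"
    then have "e = b" using e_decomp \<psi> e1 by simp
    then have "p + 0 = 0 + e" using two_b scale_left_distrib[of 1 1 e] by simp
    then have "e \<in> Even" using p_even by simp
    then have "e = 0" using parity_unique(2)[of e 0 0 e] by (simp add: parity_mem)
    then show False using e_neq_0 by simp
  qed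
  then show "\<theta> = \<beta>" using h1(2) by auto
  then show \<mu>: "\<mu> = \<beta>" using h1(1) two by (simp add: mult_2[symmetric])
  have h2: "(1 - \<alpha>) * \<nu> = 2 * \<alpha> * \<beta> + \<alpha> - 2 * \<alpha>\<^sup>2"
    using k_eq assms \<mu> by (simp add: algebra_simps)
  have "\<beta> * (\<beta> * (4 * \<alpha> - 1) - 2 * \<alpha>\<^sup>2) = 0"
    using b_coefficient_relation h2 unfolding \<mu> \<psi> by algebra
  then have h3: "\<beta> * (4 * \<alpha> - 1) = 2 * \<alpha>\<^sup>2" using \<beta>0 by simp
  \<comment> \<open>From here \<open>p\<close>, which is idempotent because \<open>f = p\<close>, is
    decomposed with respect to \<open>a\<close>. The relations for \<open>pp\<close> and
    \<open>pq\<close> are split into their components for \<alpha> and for 0 and 1.\<close>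
  have X: "mult (sc \<nu> a + p0 + p1) (sc \<nu> a + p0 + p1) = sc \<nu> a + p0 + p1"
    unfolding p_decomp[symmetric] using pp f by (simp add: scale_left_distrib[of 1 1 p, simplified])
  have mem: "a \<in> eigensum a {0, 1}" "p0 \<in> eigensum a {0, 1}" "mult p0 p0 \<in> eigensum a {0, 1}"
    "mult p1 p1 \<in> eigensum a {0, 1}" "mult p0 p1 \<in> eigenspace a \<alpha>"
    using axis_eigenspace p0 p1 fusion_00 fusion_0\<alpha> fusion_\<alpha>\<alpha>
      eigenspace_subset_eigensum[of _ "{0, 1}" a] by blast+
  have *: "(sc (\<nu>\<^sup>2) a + mult p0 p0 + mult p1 p1) + (sc (2 * \<alpha> * \<nu>) p1 + sc 2 (mult p0 p1))
      = (sc \<nu> a + p0) + p1"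
    (is "?L = ?R")
  proof (rule vec_eqI)
    fix l :: "'a \<Rightarrow> 'f" assume l: "Vector_Spaces.linear sc (*) l"
    note L = functional_simps[OF l] bilinear products mult_commute
    show "l ?L = l ?R"
      using arg_cong[OF X, of l] by (simp only: L) algebra
  qed
  have pp_\<alpha>: "sc (2 * \<alpha> * \<nu>) p1 + sc 2 (mult p0 p1) = p1"
    using jordan_unique(2)[OF *] by (simp add: closed mem p1)
  have Y: "mult (sc \<nu> a + p0 + p1) (sc \<nu> a + sc \<alpha> p1) = sc (2 * \<alpha>) (sc \<nu> a + sc \<alpha> p1)
      + sc ((1 - 2 * \<alpha>) * \<beta>) (sc \<nu> a + p0 + p1)"
  proof -
    have "mult p q = sc (2 * \<alpha>) q + sc ((1 - 2 * \<alpha>) * \<beta>) p"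
      (is "?L = ?R")
    proof (rule vec_eqI)
      fix l :: "'a \<Rightarrow> 'f" assume l: "Vector_Spaces.linear sc (*) l"
      show "l ?L = l ?R"
        using arg_cong[OF pq[unfolded f \<mu>], of l] unfolding functional_simps[OF l] by algebra
    qed
    then show ?thesis by (simp only: p_decomp[symmetric] q_eq[symmetric])
  qed
  have *: "(sc (\<nu>\<^sup>2) a + sc \<alpha> (mult p1 p1)) + (sc (\<alpha>\<^sup>2 * \<nu> + \<alpha> * \<nu>) p1 + sc \<alpha> (mult p0 p1))
      = (sc (2 * \<alpha> * \<nu> + (1 - 2 * \<alpha>) * \<beta> * \<nu>) a + sc ((1 - 2 * \<alpha>) * \<beta>) p0) + sc (2 * \<alpha>\<^sup>2 + (1 - 2 * \<alpha>) * \<beta>) p1"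
    (is "?L = ?R")
  proof (rule vec_eqI)
    fix l :: "'a \<Rightarrow> 'f" assume l: "Vector_Spaces.linear sc (*) l"
    note L = functional_simps[OF l] bilinear products mult_commute
    show "l ?L = l ?R"
      using arg_cong[OF Y, of l] by (simp only: L) algebra
  qed
  have pq_\<alpha>: "sc (\<alpha>\<^sup>2 * \<nu> + \<alpha> * \<nu>) p1 + sc \<alpha> (mult p0 p1)
      = sc (2 * \<alpha>\<^sup>2 + (1 - 2 * \<alpha>) * \<beta>) p1"
    and pq_01: "sc (\<nu>\<^sup>2) a + sc \<alpha> (mult p1 p1)
      = sc (2 * \<alpha> * \<nu> + (1 - 2 * \<alpha>) * \<beta> * \<nu>) a + sc ((1 - 2 * \<alpha>) * \<beta>) p0"
    using jordan_unique[OF *] by (simp_all add: closed mem p1)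
  show "p1 \<noteq> 0"
  proof
    assume "p1 = 0"
    then have q: "q = sc \<nu> a" and p: "p = sc \<nu> a + p0" using q_eq p_decomp by simp_all
    have eq: "sc (\<nu>\<^sup>2 - 2 * \<alpha> * \<nu> - (1 - 2 * \<alpha>) * \<beta> * \<nu>) a
        = sc ((1 - 2 * \<alpha>) * \<beta>) p0"
      using pq_01 \<open>p1 = 0\<close> by (simp add: scale_left_diff_distrib scale_left_distrib algebra_simps)
    have "sc ((1 - 2 * \<alpha>) * \<beta>) p0 = 0"
      using eigensum_eigenspace_Int[of "{0}" 1 "sc ((1 - 2 * \<alpha>) * \<beta>) p0" a] eq p0 axis_eigenspace
      by (metis closed(5) eigensum_singleton finite.emptyI finite.insertI one_neq_zero singletonD)
    moreover have "p0 \<noteq> 0"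
    proof
      assume "p0 = 0"
      then have "p = sc \<nu> a" using p by simp
      moreover from this have "mult p p = sc (\<nu> * \<nu>) a" by (simp add: bilinear idem)
      moreover have "mult p p = p" using pp f by (simp add: scale_left_distrib[of 1 1 p, simplified])
      ultimately have "sc (\<nu> * \<nu>) a = sc \<nu> a" by simp
      then have "\<nu> * \<nu> = \<nu>" using a_neq_0 by simp
      then have "\<nu> = 1" using \<open>p = sc \<nu> a\<close> p_neq_0 by auto
      then have "p = a" using \<open>p = sc \<nu> a\<close> by simp
      then have "sc \<beta> e = sc 1 e" using pe ae by simp
      then show False using scale_e_eqD \<beta>1 by blast
    qed
    ultimately have "2 * \<alpha> = 1" using \<beta>0 by simp
    then have "2 * \<beta> = 1" using h3 by algebra
    then have "2 * \<alpha> = 2 * \<beta>" using \<open>2 * \<alpha> = 1\<close> by simp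
    then show False using \<alpha>\<beta> two by simp
  qed
  \<comment> \<open>The product \<open>p0 p1\<close> is eliminated between
    \<open>pp_\<alpha>\<close> and \<open>pq_\<alpha>\<close>.\<close>
  have "sc (2 * (\<alpha>\<^sup>2 * \<nu> + \<alpha> * \<nu>) - 2 * \<alpha>\<^sup>2 * \<nu> + \<alpha>) p1
      = sc (2 * (2 * \<alpha>\<^sup>2 + (1 - 2 * \<alpha>) * \<beta>)) p1"
    (is "?L = ?R")
  proof (rule vec_eqI)
    fix l :: "'a \<Rightarrow> 'f" assume l: "Vector_Spaces.linear sc (*) l"
    show "l ?L = l ?R"
      using arg_cong[OF arg_cong[OF pp_\<alpha>, of "sc \<alpha>"], of l]
        arg_cong[OF pq_\<alpha>, of l]
      unfolding functional_simps[OF l] by algebra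
  qed
  then have h4: "2 * (\<alpha>\<^sup>2 * \<nu> + \<alpha> * \<nu>) - 2 * \<alpha>\<^sup>2 * \<nu> + \<alpha> = 2 * (2 * \<alpha>\<^sup>2 + (1 - 2 * \<alpha>) * \<beta>)"
    using \<open>p1 \<noteq> 0\<close> by simp
  have "2 * \<alpha> * (3 * \<alpha> - 1) = 0" using h2 h3 h4 by algebra
  then show al: "3 * \<alpha> = 1" using two \<alpha>0 by simp
  have "3 * \<beta> = 2" using h3 al by algebra
  have "\<beta> * (3 * \<alpha>) = (3 * \<beta>) * \<alpha>" by algebra
  then have "\<beta> * (3 * \<alpha>) = 2 * \<alpha>" by (simp only: \<open>3 * \<beta> = 2\<close>)
  then show be: "\<beta> = 2 * \<alpha>" by (simp only: al) simp
  have three: "(3::'f) \<noteq> 0" using al by auto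
  have "2 * (6 * \<nu> - 5) = 0" using h2 al be by algebra
  then have "6 * \<nu> - 5 = 0" by (rule two_cancel)
  then show nu: "6 * \<nu> = 5" by algebra
  show "p0 \<noteq> 0"
  proof
    assume "p0 = 0"
    then have "sc (2 * \<alpha> * \<nu>) p1 = sc 1 p1" using pp_\<alpha> by simp
    then have h: "2 * \<alpha> * \<nu> = 1" using \<open>p1 \<noteq> 0\<close> by (simp only: scale_cancel_right) simp
    have "9 * (2 * \<alpha> * \<nu>) = (3 * \<alpha>) * (6 * \<nu>)" by algebra
    then have "9 = (5::'f)" by (simp only: h al nu) simp
    then have "(9::'f) - 5 = 0" by simp
    then have "2 * 2 = (0::'f)" by simp
    then show False using two by (simp only: mult_eq_0_iff) simp
  qed
  have six: "6 * \<alpha> = 2" using arg_cong[OF al, of "\<lambda>x. 2 * x"] by simp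
  have Q: "sc 6 q = sc 5 a + sc 2 p1"
    unfolding q_eq by (simp add: scale_right_distrib nu six)
  have "sc (36 :: 'f) (mult p1 p1) = sc 5 a + sc 24 p0"
  proof -
    \<comment> \<open>The factor 108 clears the denominators 9, 27 and 36 that arise from \<alpha> =
      1/3, \<beta> = 2/3 and \<nu> = 5/6.\<close>
    have s: "108 * (2 * \<alpha> * \<nu> + (1 - 2 * \<alpha>) * \<beta> * \<nu> - \<nu>\<^sup>2)
        = 5"
      "108 * ((1 - 2 * \<alpha>) * \<beta>) = 24" "108 * \<alpha> = 36"
      using al be nu by algebra+
    have "sc (108 * \<alpha>) (mult p1 p1)
        = sc (108 * (2 * \<alpha> * \<nu> + (1 - 2 * \<alpha>) * \<beta> * \<nu> - \<nu>\<^sup>2)) a + sc (108 * ((1 - 2 * \<alpha>) * \<beta>)) p0"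
      (is "?L = ?R")
    proof (rule vec_eqI)
      fix l :: "'a \<Rightarrow> 'f" assume l: "Vector_Spaces.linear sc (*) l"
      note L = functional_simps[OF l] bilinear products mult_commute
      show "l ?L = l ?R"
        using arg_cong[OF pq_01, of l] by (simp only: L) algebra
    qed
    then show ?thesis unfolding s .
  qed
  moreover have "mult (sc 6 q) (sc 6 q) = mult (sc 5 a + sc 2 p1) (sc 5 a + sc 2 p1)" using Q by simp
  moreover have "sc 3 (mult a p1) = p1" using al by (simp add: ap1)
  moreover have "sc 6 p = sc 5 a + sc 6 p0 + sc 6 p1"
    by (subst p_decomp) (simp add: scale_right_distrib nu)
  ultimately have "sc 36 (sc 27 (mult q q)) = sc 36 (sc 10 a + sc 9 q + sc 2 p)"
  proof (intro vec_eqI, goal_cases)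
    case (1 l)
    note L = functional_simps[OF 1(5)] bilinear idem mult_commute[of p1 a]
    show ?case
      \<comment> \<open>With these multipliers the five relations combine linearly to the goal,
        without any division.\<close>
      using arg_cong[OF arg_cong[OF 1(1), of "sc 3"], of l] arg_cong[OF
        arg_cong[OF 1(2), of "sc 27"], of l]
        arg_cong[OF arg_cong[OF 1(3), of "sc 180"], of l] arg_cong[OF arg_cong[OF 1(4), of "sc 12"], of l]
        arg_cong[OF arg_cong[OF Q, of "sc 54"], of l]
      unfolding L by algebra
  qed
  moreover have "(36 :: 'f) = 2 * 2 * (3 * 3)" by simp
  then have "(36 :: 'f) \<noteq> 0" using two three by (simp only: mult_eq_0_iff) simp
  ultimately show "sc 27 (mult q q) = sc 10 a + sc 9 q + sc 2 p" by (rule scale_left_imp_eq[rotated])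
qed

section \<open>Linear independence of \<open>a\<close>, \<open>p\<close>, \<open>e\<close> and of
  \<open>a\<close>, \<open>p\<close>, \<open>q\<close>, \<open>e\<close>\<close>

lemma a_p_e_coefficients:
  assumes "sc r a + sc s p + sc t e = 0" "\<And>x. p \<noteq> sc x a"
  shows "r = 0" "s = 0" "t = 0"
proof -
  have *: "(sc r a + sc s p) + sc t e = 0 + 0" using assms(1) by simp
  have "sc r a + sc s p = sc 0 a + sc 0 p" "sc t e = 0"
    using parity_unique[OF *] by (simp_all add: parity_mem)
  then show "r = 0" "s = 0" "t = 0"
    using a_p_coefficients[of r s 0 0] assms(2) e_neq_0 by auto
qed

text \<open>After parity splits off \<open>e\<close>, the vectors \<open>p\<close> and
  \<open>q\<close> are expanded in \<open>a\<close>, \<open>p0\<close> and \<open>p1\<close>, which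
  are nonzero and belong to the distinct eigenvalues 1, 0 and \<alpha>.\<close>

lemma a_p_q_e_coefficients:
  assumes "sc r a + sc s p + sc t q + sc u e = 0" "p0 \<noteq> 0" "p1 \<noteq> 0"
  shows "r = 0" "s = 0" "t = 0" "u = 0"
proof -
  have *: "(sc r a + sc s p + sc t q) + sc u e = 0 + 0" using assms(1) by simp
  have E: "sc r a + sc s p + sc t q = 0" "sc u e = 0"
    using parity_unique[OF *] by (simp_all add: parity_mem)
  show "u = 0" using E(2) e_neq_0 by simp
  have mem: "a \<in> eigensum a {0, 1}" "p0 \<in> eigensum a {0, 1}"
    using axis_eigenspace p0 eigenspace_subset_eigensum[of _ "{0, 1}" a] by blast+
  have **: "(sc s p0 + sc (r + s * \<nu> + t * \<nu>) a) + sc (s + t * \<alpha>) p1 = 0 + 0"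
    (is "?L = ?R")
  proof (rule vec_eqI)
    fix l :: "'a \<Rightarrow> 'f" assume l: "Vector_Spaces.linear sc (*) l"
    show "l ?L = l ?R"
      using arg_cong[OF E(1), of l] arg_cong[OF p_decomp, of l] arg_cong[OF q_eq, of l]
      unfolding functional_simps[OF l] by algebra
  qed
  have F: "sc s p0 + sc (r + s * \<nu> + t * \<nu>) a = 0 + 0" "sc (s + t * \<alpha>) p1 = 0"
    using jordan_unique[OF **] by (simp_all add: closed mem p1)
  have G: "sc s p0 = 0" "sc (r + s * \<nu> + t * \<nu>) a = 0"
    using eigensum_eigenspace_unique[OF _ _ F(1), of "{0}" 1 a]
    by (simp_all add: closed p0 axis_eigenspace eigensum_singleton)
  show "s = 0" using G(1) assms(2) by simp
  then show "t = 0" using F(2) assms(3) \<alpha>0 by simp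
  then show "r = 0" using G(2) \<open>s = 0\<close> a_neq_0 by simp
qed

section \<open>Identification of the algebras\<close>

text \<open>Lets the simplifier reduce the vanishing of denominators such as 4 or 6 to that of 2 or
  3.\<close>

lemma numeral_Bit0_eq_0: "(numeral (num.Bit0 n) :: 'f) = 0 \<longleftrightarrow> (numeral n :: 'f) = 0"
proof -
  have "(numeral (num.Bit0 n) :: 'f) = 2 * numeral n"
    by (simp only: mult_2 numeral_Bit0[of n])
  then show ?thesis using two by (simp only: mult_eq_0_iff simp_thms)
qed

lemma b_eq: "b = sc (1 / 2) (p + e)"
  using two by (simp add: two_b[symmetric])

lemma algebra_iso_3C:
  assumes "k \<noteq> 0"
  shows "algebra_iso sc mult (*s) (mult_3C2 \<alpha>)"
proof -
  note dep = dependent_case[OF assms]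
  have indep: "p \<noteq> sc x a" for x using p_not_multiple[OF assms] .
  have \<beta>: "\<beta> = 1 - \<alpha>" using dep(1) by (simp add: algebra_simps)
  note rules = idem ap[unfolded dep(2)] ae[unfolded \<beta>] pe pp[unfolded dep(3)] ee[unfolded dep(3)]
  show ?thesis
  \<comment> \<open>For \<alpha> = -1 the vectors of the first case become dependent, since
    \<open>v Bx\<close> would be \<open>- p\<close> while \<open>v By + v Bz\<close> is
    \<open>p\<close>. A different basis is used there, in line with the convention in
    \<open>mult_3C2\<close>.\<close>
  proof (cases "\<alpha> = - 1")
    case False
    then have \<alpha>1': "\<alpha> + 1 \<noteq> 0" by (simp add: eq_neg_iff_add_eq_0)
    \<comment> \<open>The image of \<open>x\<close> is \<open>\<one> - a\<close>, found by solving \<open>bc = \<alpha>/2 (b + c - x)\<close>.\<close>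
    define v where "v i = (case i of Bx \<Rightarrow> sc (1 / \<alpha>) (p - sc (\<alpha> + 1) a)
      | By \<Rightarrow> sc (1 / 2) (p + e) | Bz \<Rightarrow> sc (1 / 2) (p - e))" for i
    have "algebra_iso sc mult (*s) (table_mult (table_3C \<alpha>))"
    proof (rule algebra_iso_table_mult[OF _ _ generates])
      show "mult (v i) (v j) = (\<Sum>k\<in>UNIV. sc (table_3C \<alpha> i j $ k) (v k))" for i j
      proof (rule vec_eqI)
        fix l :: "'a \<Rightarrow> 'f" assume l: "Vector_Spaces.linear sc (*) l"
        show "l (mult (v i) (v j)) = l (\<Sum>k\<in>UNIV. sc (table_3C \<alpha> i j $ k) (v k))"
          using \<alpha>0 two
          by (cases i; cases j) (simp_all add: numeral_Bit0_eq_0 UNIV_idx3C v_def axis_def functional_simps[OF l]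
              bilinear rules rules[THEN mult_swap] field_simps)
      qed
    next
      fix c k assume "(\<Sum>k\<in>UNIV. sc (c k) (v k)) = 0"
      moreover have "(\<Sum>k\<in>UNIV. sc (c k) (v k)) = sc (- c Bx * (\<alpha> + 1) / \<alpha>) a
        + sc (c Bx / \<alpha> + c By / 2 + c Bz / 2) p + sc (c By / 2 - c Bz / 2) e"
      proof (rule vec_eqI)
        fix l :: "'a \<Rightarrow> 'f" assume l: "Vector_Spaces.linear sc (*) l"
        show "l (\<Sum>k\<in>UNIV. sc (c k) (v k)) = l (sc (- c Bx * (\<alpha> + 1) / \<alpha>) a
        + sc (c Bx / \<alpha> + c By / 2 + c Bz / 2) p + sc (c By / 2 - c Bz / 2) e)"
          using \<alpha>0 two by (simp add: numeral_Bit0_eq_0 UNIV_idx3C v_def functional_simps[OF l] field_simps)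
      qed
      ultimately have "sc (- c Bx * (\<alpha> + 1) / \<alpha>) a
        + sc (c Bx / \<alpha> + c By / 2 + c Bz / 2) p + sc (c By / 2 - c Bz / 2) e = 0" by simp
      note c = a_p_e_coefficients[OF this indep]
      have "c Bx = 0" using c(1) \<alpha>0 \<alpha>1' by (simp only: divide_eq_0_iff mult_eq_0_iff neg_equal_0_iff_equal) simp
      moreover from this have "c By + c Bz = 0" "c By - c Bz = 0" using c(2,3) two
        by (simp_all flip: add_divide_distrib diff_divide_distrib)
      moreover from this have "2 * c By = 0" by algebra
      ultimately show "c k = 0" using two by (cases k) auto
    next
      fix x assume "x \<in> {a, b}"
      then consider "x = a" | "x = b" by blast
      then show "\<exists>c. x = (\<Sum>k\<in>UNIV. sc (c k) (v k))"
      proof cases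
        case 1
        \<comment> \<open>The coordinates of \<open>a\<close> come from solving \<alpha>
          \<open>v Bx\<close> = \<open>p\<close> - (\<alpha> + 1) \<open>a\<close> with
          \<open>p = v By + v Bz\<close>.\<close>
        define d where "d = 1 / (\<alpha> + 1)"
        have d: "d * (\<alpha> + 1) = 1" using \<alpha>1' by (simp add: d_def)
        show ?thesis
        proof (rule exI[of _ "\<lambda>k. case k of Bx \<Rightarrow> - \<alpha> * d | _ \<Rightarrow> d"], rule vec_eqI)
          fix l :: "'a \<Rightarrow> 'f" assume l: "Vector_Spaces.linear sc (*) l"
          show "l x
              = l (\<Sum>k\<in>UNIV. sc (case k of Bx \<Rightarrow> - \<alpha> * d | _ \<Rightarrow> d) (v k))"
            using \<alpha>0 two by (simp add: numeral_Bit0_eq_0 1 UNIV_idx3C v_def functional_simps[OF l] field_simps) (use d in algebra)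
        qed
      next
        case 2
        show ?thesis
          by (rule exI[of _ "\<lambda>k. case k of By \<Rightarrow> 1 | _ \<Rightarrow> 0"]) (simp add: numeral_Bit0_eq_0 2 UNIV_idx3C v_def b_eq)
      qed
    qed
    then show ?thesis using False by (simp add: mult_3C2_def mult_3C_def)
  next
    case True
    \<comment> \<open>In characteristic 3 the eigenvalues -1 and 2 would coincide.\<close>
    have three: "(3::'f) \<noteq> 0"
    proof
      assume "(3::'f) = 0"
      then have "\<beta> - \<alpha> = 0" by (simp add: \<beta> True)
      then show False using \<alpha>\<beta> by simp
    qed
    note rules = rules[unfolded True, simplified]
    \<comment> \<open>The identity is \<open>a - p\<close>, and \<open>x, y, z\<close> correspond to \<open>a, \<one> - b, \<one> - c\<close>.\<close>
    define v where "v i = (case i of Bx \<Rightarrow> a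
      | By \<Rightarrow> a - sc (1 / 2) (sc 3 p + e) | Bz \<Rightarrow> a - sc (1 / 2) (sc 3 p - e))" for i
    have "algebra_iso sc mult (*s) (table_mult (table_3C 2))"
    proof (rule algebra_iso_table_mult[OF _ _ generates])
      show "mult (v i) (v j) = (\<Sum>k\<in>UNIV. sc (table_3C 2 i j $ k) (v k))" for i j
      proof (rule vec_eqI)
        fix l :: "'a \<Rightarrow> 'f" assume l: "Vector_Spaces.linear sc (*) l"
        show "l (mult (v i) (v j)) = l (\<Sum>k\<in>UNIV. sc (table_3C 2 i j $ k) (v k))"
          using two
          by (cases i; cases j) (simp_all add: numeral_Bit0_eq_0 UNIV_idx3C v_def axis_def functional_simps[OF l]
              bilinear rules rules[THEN mult_swap] field_simps)
      qed
    next
      fix c k assume "(\<Sum>k\<in>UNIV. sc (c k) (v k)) = 0"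
      moreover have "(\<Sum>k\<in>UNIV. sc (c k) (v k)) = sc (c Bx + c By + c Bz) a
        + sc (- 3 * (c By + c Bz) / 2) p + sc ((c Bz - c By) / 2) e"
      proof (rule vec_eqI)
        fix l :: "'a \<Rightarrow> 'f" assume l: "Vector_Spaces.linear sc (*) l"
        show "l (\<Sum>k\<in>UNIV. sc (c k) (v k)) = l (sc (c Bx + c By + c Bz) a
        + sc (- 3 * (c By + c Bz) / 2) p + sc ((c Bz - c By) / 2) e)"
          using two by (simp add: numeral_Bit0_eq_0 UNIV_idx3C v_def functional_simps[OF l] field_simps)
      qed
      ultimately have "sc (c Bx + c By + c Bz) a
        + sc (- 3 * (c By + c Bz) / 2) p + sc ((c Bz - c By) / 2) e = 0" by simp
      note c = a_p_e_coefficients[OF this indep]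
      have "c By + c Bz = 0" "c Bz - c By = 0" using c(2,3) two three
        by (simp_all only: divide_eq_0_iff mult_eq_0_iff neg_equal_0_iff_equal) simp_all
      moreover from this have "2 * c By = 0" by algebra
      moreover note c(1)
      ultimately show "c k = 0" using two by (cases k) auto
    next
      fix x assume "x \<in> {a, b}"
      then consider "x = a" | "x = b" by blast
      then show "\<exists>c. x = (\<Sum>k\<in>UNIV. sc (c k) (v k))"
      proof cases
        case 1
        show ?thesis
          by (rule exI[of _ "\<lambda>k. case k of Bx \<Rightarrow> 1 | _ \<Rightarrow> 0"]) (simp add: numeral_Bit0_eq_0 1 UNIV_idx3C v_def)
      next
        case 2
        \<comment> \<open>Expressing \<open>b\<close> amounts to solving
          \<open>v By + v Bz = 2 a - 3 p\<close> and \<open>v By - v Bz = - e\<close> for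
          \<open>p\<close> and \<open>e\<close>, which requires division by 3.\<close>
        define d :: 'f where "d = 1 / 3"
        have d: "d * 3 = 1" using three by (simp add: d_def)
        show ?thesis
        proof (rule exI[of _ "\<lambda>k. case k of Bx \<Rightarrow> d | By \<Rightarrow> - 2 * d | Bz \<Rightarrow> d"], rule vec_eqI)
          fix l :: "'a \<Rightarrow> 'f" assume l: "Vector_Spaces.linear sc (*) l"
          show "l x
              = l (\<Sum>k\<in>UNIV. sc (case k of Bx \<Rightarrow> d | By \<Rightarrow> - 2 * d | Bz \<Rightarrow> d) (v k))"
            using two by (simp add: numeral_Bit0_eq_0 2 b_eq UNIV_idx3C v_def functional_simps[OF l] field_simps)
              (use d in algebra)
        qed
      qed
    qed
    then show ?thesis using True by (simp add: mult_3C2_def mult_3C_def)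
  qed
qed

text \<open>The products are stated with cleared denominators, so that the same list serves in
  characteristic 5 and outside it.\<close>

lemma orthogonal_products:
  assumes "k = 0"
  shows "(3::'f) \<noteq> 0" "\<alpha> = 1 / 3" "\<beta> = 2 / 3" "mult p p = p" "mult e e = p"
    "sc 9 (mult a q) = sc 3 q + sc 5 a" "sc 9 (mult p q) = sc 6 q + sc 2 p"
    "sc 3 (mult q e) = sc 2 e"
proof -
  note orth = orthogonal_case[OF assms]
  note al = orth(2) and be = orth(3) and nu = orth(4)
  show three: "(3::'f) \<noteq> 0" using al by auto
  then show \<alpha>: "\<alpha> = 1 / 3" using al by (simp add: field_simps)
  then show "\<beta> = 2 / 3" by (simp only: be) simp
  show "mult p p = p" using pp orth(1) scale_left_distrib[of 1 1 p] by simp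
  show "mult e e = p" using ee orth(1) by simp
  have nine: "9 * \<alpha> = 3" using arg_cong[OF al, of "\<lambda>x. 3 * x"] by simp
  have "9 * ((1 - \<alpha>) * \<nu>) = (9 - 9 * \<alpha>) * \<nu>" by algebra
  then have "9 * ((1 - \<alpha>) * \<nu>) = 5" unfolding nine using nu by simp
  then show "sc 9 (mult a q) = sc 3 q + sc 5 a"
    by (simp add: aq scale_right_distrib nine)
  have "9 * (2 * \<alpha>) = 2 * (9 * \<alpha>)" by algebra
  moreover have "9 * (2 * \<alpha> - 4 * \<alpha>\<^sup>2) = 6 * (3 * \<alpha>) - 4 * (3 * \<alpha>)\<^sup>2" by algebra
  ultimately have c: "9 * (2 * \<alpha>) = 6" "9 * (2 * \<alpha> - 4 * \<alpha>\<^sup>2) = 2"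
    unfolding nine al by simp_all
  have "sc 9 (mult p q)
      = sc (9 * (2 * \<alpha>)) q + sc (9 * (2 * \<alpha> - 4 * \<alpha>\<^sup>2)) p"
    (is "?L = ?R")
  proof (rule vec_eqI)
    fix l :: "'a \<Rightarrow> 'f" assume l: "Vector_Spaces.linear sc (*) l"
    show "l ?L = l ?R"
      unfolding pq orth(1) orth(8) be functional_simps[OF l] by algebra
  qed
  then show "sc 9 (mult p q) = sc 6 q + sc 2 p" unfolding c .
  have "3 * \<theta> = 3 * \<beta>" by (simp only: orth(9))
  also have "\<dots> = 2 * (3 * \<alpha>)" unfolding be by algebra
  finally show "sc 3 (mult q e) = sc 2 e" by (simp add: qe al)
qed

lemma algebra_iso_Q2:
  assumes "k = 0" "(5::'f) \<noteq> 0"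
  shows "algebra_iso sc mult (*s) (mult_Q2 :: 'f ^ idxQ2 \<Rightarrow> _)"
proof -
  note prod = orthogonal_products[OF assms(1)]
  note three = prod(1)
  \<comment> \<open>The identity is \<open>6 a + 3 p - 9 q\<close>; \<open>D\<close> is its difference with \<open>a\<close>, and \<open>D'\<close> is then
    determined by the product of \<open>s\<^sub>1\<close> and \<open>d\<^sub>1\<close>.\<close>
  define D D' where "D = sc 5 a + sc 3 p - sc 9 q" and "D' = sc 5 a + p - sc 6 q"
  define S S' where "S = sc (1 / 2) (p + e)" and "S' = sc (1 / 2) (p - e)"
  have cancel: "x = y" if "sc r x = sc r y" "r \<noteq> 0" for r x y
    using scale_left_imp_eq that by blast
  have ae3: "sc 3 (mult a e) = sc 2 e" using three by (simp add: ae prod(3))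
  have D: "sc 3 (mult p D) = p + D - D'" "sc 3 (mult p D') = p - D + D'"
    "sc 3 (mult e D) = e" "sc 3 (mult e D') = e"
    "mult D D = D" "sc 3 (mult D' D') = sc 3 D'" "sc 3 (mult D D') = D + D' - p"
  proof -
    { fix l :: "'a \<Rightarrow> 'f" assume l: "Vector_Spaces.linear sc (*) l"
      note L = functional_simps[OF l] bilinear idem ap ap[THEN mult_swap] pe pe[THEN mult_swap]
        prod(4,5) mult_commute[of q a] mult_commute[of q p] mult_commute[of e q]
        mult_commute[of e a]
      have aq: "9 * l (mult a q) = 3 * l q + 5 * l a"
        and pq: "9 * l (mult p q) = 6 * l q + 2 * l p"
        and qe: "3 * l (mult q e) = 2 * l e"
        and qq: "27 * l (mult q q) = 10 * l a + 9 * l q + 2 * l p"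
        and ae: "3 * l (mult a e) = 2 * l e"
        using prod(6-8)[THEN arg_cong, of l] ae3[THEN arg_cong, of l]
          orthogonal_case(7)[OF assms(1), THEN arg_cong, of l] by (simp_all add: functional_simps[OF l])
      have "l (sc 3 (mult p D)) = l (p + D - D')" "l (sc 3 (mult p D')) = l (p - D + D')"
        "l (sc 3 (mult e D)) = l e" "l (sc 3 (mult e D')) = l e"
        "l (mult D D) = l D" "l (sc 3 (mult D' D')) = l (sc 3 D')"
        "l (sc 3 (mult D D')) = l (D + D' - p)"
        unfolding D_def D'_def L using aq pq qe qq ae by algebra+ }
    then show "sc 3 (mult p D) = p + D - D'" "sc 3 (mult p D') = p - D + D'"
      "sc 3 (mult e D) = e" "sc 3 (mult e D') = e"
      "mult D D = D" "sc 3 (mult D' D') = sc 3 D'" "sc 3 (mult D D') = D + D' - p"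
      by (blast intro: vec_eqI)+
  qed
  have p: "p = S + S'" and e: "e = S - S'"
  proof -
    have "sc 2 p = sc 2 (S + S')" "sc 2 e = sc 2 (S - S')"
      using two scale_left_distrib[of 1 1 p] scale_left_distrib[of 1 1 e]
      by (simp_all add: S_def S'_def scale_right_distrib scale_right_diff_distrib)
    then show "p = S + S'" "e = S - S'" using cancel two by blast+
  qed
  have six: "(6::'f) \<noteq> 0" using three by (simp add: numeral_Bit0_eq_0)
  have four: "(4::'f) \<noteq> 0" using two by (simp add: numeral_Bit0_eq_0)
  have S: "mult S S = S" "mult S' S' = S'" "mult S S' = 0"
    "mult S D = sc (1 / 6) (sc 2 S + D - D')" "mult S D' = sc (1 / 6) (sc 2 S - D + D')"
    "mult S' D = sc (1 / 6) (sc 2 S' + D - D')" "mult S' D' = sc (1 / 6) (sc 2 S' - D + D')"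
    "mult D' D' = D'" "mult D D' = sc (1 / 3) (D + D' - S - S')"
  proof -
    { fix l :: "'a \<Rightarrow> 'f" assume l: "Vector_Spaces.linear sc (*) l"
      note L = functional_simps[OF l] bilinear mult_commute[of S' S]
      have h: "l (mult p p) = l p" "l (mult p e) = l e" "l (mult e e) = l p"
        "l (sc 3 (mult p D)) = l (p + D - D')" "l (sc 3 (mult p D')) = l (p - D + D')"
        "l (sc 3 (mult e D)) = l e" "l (sc 3 (mult e D')) = l e"
        by (simp_all add: prod(4,5) pe D)
      have "l (sc 4 (mult S S)) = l (sc 4 S)" "l (sc 4 (mult S' S')) = l (sc 4 S')"
        "l (sc 4 (mult S S')) = l (sc 4 0)"
        "l (sc 6 (mult S D)) = l (sc 2 S + D - D')" "l (sc 6 (mult S D')) = l (sc 2 S - D + D')"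
        "l (sc 6 (mult S' D)) = l (sc 2 S' + D - D')" "l (sc 6 (mult S' D')) = l (sc 2 S' - D + D')"
        using h unfolding p e L by algebra+ }
    then have "sc 4 (mult S S) = sc 4 S" "sc 4 (mult S' S') = sc 4 S'" "sc 4 (mult S S') = sc 4 0"
      and E: "sc 6 (mult S D) = sc 2 S + D - D'" "sc 6 (mult S D') = sc 2 S - D + D'"
        "sc 6 (mult S' D) = sc 2 S' + D - D'" "sc 6 (mult S' D') = sc 2 S' - D + D'"
      by (blast intro: vec_eqI)+
    then show "mult S S = S" "mult S' S' = S'" "mult S S' = 0" using cancel four by blast+
    show "mult D' D' = D'" using cancel D(6) three by blast
    show "mult S D = sc (1 / 6) (sc 2 S + D - D')" "mult S D' = sc (1 / 6) (sc 2 S - D + D')"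
      "mult S' D = sc (1 / 6) (sc 2 S' + D - D')" "mult S' D' = sc (1 / 6) (sc 2 S' - D + D')"
      unfolding E[symmetric] using six by simp_all
    have E: "sc 3 (mult D D') = D + D' - S - S'" using D(7) by (simp add: p algebra_simps)
    show "mult D D' = sc (1 / 3) (D + D' - S - S')" unfolding E[symmetric] using three by simp
  qed
  have third: "1 / 3 = (1 / 6 :: 'f) * 2" using three six by (simp add: field_simps)
  define v where "v i = (case i of S1 \<Rightarrow> S | S2 \<Rightarrow> S' | D1 \<Rightarrow> D | D2 \<Rightarrow> D')" for i
  show ?thesis unfolding mult_Q2_def
  proof (rule algebra_iso_table_mult[OF _ _ generates])
    show "mult (v i) (v j) = (\<Sum>k\<in>UNIV. sc (table_Q2 i j $ k) (v k))" for i j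
      by (cases i; cases j) (simp_all add: UNIV_idxQ2 v_def axis_def S S[THEN mult_swap] D(5)
          third scale_right_distrib scale_right_diff_distrib)
  next
    fix c k assume "(\<Sum>k\<in>UNIV. sc (c k) (v k)) = 0"
    moreover have "(\<Sum>k\<in>UNIV. sc (c k) (v k)) = sc (5 * (c D1 + c D2)) a
        + sc ((c S1 + c S2) / 2 + 3 * c D1 + c D2) p + sc (- 9 * c D1 - 6 * c D2) q
        + sc ((c S1 - c S2) / 2) e"
    proof (rule vec_eqI)
      fix l :: "'a \<Rightarrow> 'f" assume l: "Vector_Spaces.linear sc (*) l"
      show "l (\<Sum>k\<in>UNIV. sc (c k) (v k)) = l (sc (5 * (c D1 + c D2)) a
        + sc ((c S1 + c S2) / 2 + 3 * c D1 + c D2) p + sc (- 9 * c D1 - 6 * c D2) q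
        + sc ((c S1 - c S2) / 2) e)"
        using two by (simp add: numeral_Bit0_eq_0 UNIV_idxQ2 v_def S_def S'_def D_def D'_def functional_simps[OF l] field_simps)
    qed
    ultimately have "sc (5 * (c D1 + c D2)) a
        + sc ((c S1 + c S2) / 2 + 3 * c D1 + c D2) p + sc (- 9 * c D1 - 6 * c D2) q
        + sc ((c S1 - c S2) / 2) e = 0" by simp
    note c = a_p_q_e_coefficients[OF this orthogonal_case(5,6)[OF assms(1)]]
    have "c D1 + c D2 = 0" "c S1 - c S2 = 0" using c(1,4) two assms(2)
      by (simp_all only: mult_eq_0_iff divide_eq_0_iff simp_thms)
    with c(2,3) have c: "c D1 + c D2 = 0" "(c S1 + c S2) / 2 + 3 * c D1 + c D2 = 0"
      "- 9 * c D1 - 6 * c D2 = 0" "c S1 - c S2 = 0" by blast+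
    have "3 * c D1 = 0" using c(1,3) by algebra
    then have "c D1 = 0" using three by simp
    then have "c D2 = 0" "c S1 + c S2 = 0" using c(1,2) two by simp_all
    moreover from this c(4) have "2 * c S1 = 0" by algebra
    ultimately show "c k = 0" using two c(4) \<open>c D1 = 0\<close> by (cases k) auto
  next
    fix x assume "x \<in> {a, b}"
    then consider "x = a" | "x = b" by blast
    then show "\<exists>c. x = (\<Sum>k\<in>UNIV. sc (c k) (v k))"
    proof cases
      case 1
      \<comment> \<open>The coordinates are those of \<open>a\<close> = 1 - \<open>D\<close>, where
        the identity is 3/5 times the sum of the four basis vectors.\<close>
      define d :: 'f where "d = 1 / 5"
      have d: "d * 5 = 1" using assms(2) by (simp add: d_def)
      show ?thesis
      proof (rule exI[of _ "\<lambda>k. case k of D1 \<Rightarrow> - 2 * d | _ \<Rightarrow> 3 * d"], rule vec_eqI)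
        fix l :: "'a \<Rightarrow> 'f" assume l: "Vector_Spaces.linear sc (*) l"
        have "l p = l S + l S'" "l D = 5 * l a + 3 * l p - 9 * l q" "l D' = 5 * l a + l p - 6 * l q"
          by (simp_all add: D_def D'_def functional_simps[OF l]) (simp add: p functional_simps[OF l])
        then have "l a = 3 * d * l S + (3 * d * l S' + (3 * d * l D' - 2 * d * l D))"
          using d by algebra
        then show "l x = l (\<Sum>k\<in>UNIV. sc (case k of D1 \<Rightarrow> - 2 * d | _ \<Rightarrow> 3 * d) (v k))"
          by (simp add: 1 UNIV_idxQ2 v_def functional_simps[OF l])
      qed
    next
      case 2
      show ?thesis
        by (rule exI[of _ "\<lambda>k. case k of S1 \<Rightarrow> 1 | _ \<Rightarrow> 0"]) (simp add: 2 UNIV_idxQ2 v_def S_def b_eq)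
    qed
  qed
qed

lemma algebra_iso_Q2x:
  assumes "k = 0" "(5::'f) = 0"
  shows "algebra_iso sc mult (*s) (mult_Q2x :: 'f ^ idxQ2x \<Rightarrow> _)"
proof -
  note prod = orthogonal_products[OF assms(1)]
  note mod_5 = assms(2) numeral_mod_5[OF assms(2)]
  have half: "1 / 2 = (3::'f)" and third: "2 / 3 = (4::'f)"
    using two prod(1) by (simp_all add: field_simps mod_5)
  have aq: "mult a q = sc 2 q" and pq: "mult p q = sc 4 q + sc 3 p"
    and qe: "mult q e = sc 4 e" and qq: "mult q q = sc 2 q + p"
  proof -
    have four: "(4::'f) \<noteq> 0" using two by (simp add: numeral_Bit0_eq_0)
    \<comment> \<open>Modulo 5 the factors 9 and 27 become 4 and 2, and the coefficients 5 and 10 of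
      \<open>a\<close> vanish. Both sides are written with a common factor that can be
      cancelled.\<close>
    have "sc 4 (mult a q) = sc 4 (sc 2 q)" "sc 4 (mult p q) = sc 4 (sc 4 q + sc 3 p)"
      "sc 3 (mult q e) = sc 3 (sc 4 e)" "sc 2 (mult q q) = sc 2 (sc 2 q + p)"
      using prod(6-8) orthogonal_case(7)[OF assms(1)]
      by (simp_all add: mod_5 scale_right_distrib)
    then show "mult a q = sc 2 q" "mult p q = sc 4 q + sc 3 p"
      "mult q e = sc 4 e" "mult q q = sc 2 q + p"
      using scale_left_imp_eq four prod(1) two by blast+
  qed
  note rules = idem ap ae[unfolded prod(3) third] pe prod(4,5) aq pq qe qq
  have b: "b = sc 3 p + sc 3 e" using b_eq by (simp add: half scale_right_distrib)
  \<comment> \<open>In characteristic 5 the identity \<open>6 a + 3 p - 9 q\<close> becomes \<open>a + 3 p + q\<close>.\<close>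
  define v where "v i = (case i of Ex \<Rightarrow> sc 3 p + sc 3 e | Ey \<Rightarrow> sc 3 p + sc 2 e
    | Ez \<Rightarrow> sc 3 p + q | E1 \<Rightarrow> a + sc 3 p + q)" for i
  show ?thesis unfolding mult_Q2x_def
  proof (rule algebra_iso_table_mult[OF _ _ generates])
    show "mult (v i) (v j) = (\<Sum>k\<in>UNIV. sc (table_Q2x i j $ k) (v k))" for i j
    proof (rule vec_eqI)
      fix l :: "'a \<Rightarrow> 'f" assume l: "Vector_Spaces.linear sc (*) l"
      show "l (mult (v i) (v j)) = l (\<Sum>k\<in>UNIV. sc (table_Q2x i j $ k) (v k))"
        by (cases i; cases j, simp_all only: UNIV_idxQ2x v_def idxQ2x.case table_Q2x.simps)
          (simp_all add: axis_def functional_simps[OF l] bilinear rules rules[THEN mult_swap],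
            simp_all add: algebra_simps, simp_all add: mod_5)
    qed
  next
    fix c k assume "(\<Sum>k\<in>UNIV. sc (c k) (v k)) = 0"
    moreover have "(\<Sum>k\<in>UNIV. sc (c k) (v k)) = sc (c E1) a
        + sc (3 * (c Ex + c Ey + c Ez + c E1)) p + sc (c Ez + c E1) q
        + sc (3 * c Ex + 2 * c Ey) e"
    proof (rule vec_eqI)
      fix l :: "'a \<Rightarrow> 'f" assume l: "Vector_Spaces.linear sc (*) l"
      show "l (\<Sum>k\<in>UNIV. sc (c k) (v k)) = l (sc (c E1) a
        + sc (3 * (c Ex + c Ey + c Ez + c E1)) p + sc (c Ez + c E1) q
        + sc (3 * c Ex + 2 * c Ey) e)"
        by (simp add: UNIV_idxQ2x v_def functional_simps[OF l] algebra_simps)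
    qed
    ultimately have "sc (c E1) a
        + sc (3 * (c Ex + c Ey + c Ez + c E1)) p + sc (c Ez + c E1) q
        + sc (3 * c Ex + 2 * c Ey) e = 0" by simp
    note c = a_p_q_e_coefficients[OF this orthogonal_case(5,6)[OF assms(1)]]
    have "c Ex + c Ey + c Ez + c E1 = 0" using c(2) prod(1) by (simp only: mult_eq_0_iff simp_thms)
    then have c: "c E1 = 0" "c Ex + c Ey = 0" "c Ez = 0" "3 * c Ex + 2 * c Ey = 0"
      using c by simp_all
    have "c Ex = 0" using c(2,4) by algebra
    then show "c k = 0" using c by (cases k) auto
  next
    fix x assume "x \<in> {a, b}"
    then consider "x = a" | "x = b" by blast
    then show "\<exists>c. x = (\<Sum>k\<in>UNIV. sc (c k) (v k))"
    proof cases
      case 1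
      show ?thesis
        \<comment> \<open>The vector \<open>v Ez\<close> is the identity minus
          \<open>a\<close>.\<close>
        by (rule exI[of _ "\<lambda>k. case k of E1 \<Rightarrow> 1 | Ez \<Rightarrow> - 1 | _ \<Rightarrow> 0"])
          (simp add: 1 UNIV_idxQ2x v_def)
    next
      case 2
      show ?thesis
        by (rule exI[of _ "\<lambda>k. case k of Ex \<Rightarrow> 1 | _ \<Rightarrow> 0"]) (simp add: 2 UNIV_idxQ2x v_def b)
    qed
  qed
qed

lemma classification:
  "(algebra_iso sc mult (*s) (mult_3C2 \<alpha>) \<and> \<alpha> \<noteq> 1/2 \<and> \<alpha> + \<beta> = 1) \<or>
    ((\<alpha>, \<beta>) = (1/3, 2/3) \<and>
      (CHAR('f) \<noteq> 5 \<longrightarrow> algebra_iso sc mult (*s) (mult_Q2 :: 'f ^ idxQ2 \<Rightarrow> _)) \<and>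
      (CHAR('f) = 5 \<longrightarrow> algebra_iso sc mult (*s) (mult_Q2x :: 'f ^ idxQ2x \<Rightarrow> _)))"
proof (cases "k = 0")
  case True
  have "(5::'f) = 0" if "CHAR('f) = 5" using of_nat_CHAR[where ?'a = 'f] that by simp
  then show ?thesis
    using algebra_iso_Q2[OF True] algebra_iso_Q2x[OF True] orthogonal_products(2,3)[OF True]
      five_neq_zero_of_CHAR by blast
next
  case False
  have "\<alpha> \<noteq> 1/2"
  proof
    assume "\<alpha> = 1/2"
    then have "2 * \<alpha> = 1" using two by (simp add: mult.commute)
    then have "2 * (\<alpha> - \<beta>) = 0" using dependent_case(1)[OF False] by algebra
    then have "\<alpha> = \<beta>" using two by simp
    then show False using \<alpha>\<beta> by simp
  qed
  then show ?thesis using algebra_iso_3C[OF False] dependent_case(1)[OF False] by blast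
qed

end

section \<open>From the axet to a skew pair\<close>

context comm_algebra
begin

text \<open>All data of \<open>skew_pair\<close> come from decompositions: twice the even and odd
  parts of \<open>b\<close> with respect to \<open>a\<close> serve as \<open>p\<close> and
  \<open>e\<close>, and \<open>moves\<close> makes \<open>e\<close> nonzero.\<close>

lemma classification_of_axis_pair:
  assumes "CHAR('f) \<noteq> 2"
    and "\<alpha> \<notin> {0, 1}" "\<beta> \<notin> {0, 1}" "\<alpha> \<noteq> \<beta>"
    and axes: "monster_axis \<alpha> \<beta> a" "monster_axis \<alpha> \<beta> b"
    and generates: "subalgebra hull {a, b} = UNIV"
    and moves: "miyamoto \<alpha> \<beta> a b \<noteq> b"
    and fixed: "miyamoto \<alpha> \<beta> b a = a" "miyamoto \<alpha> \<beta> b b = b"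
  shows "(algebra_iso sc mult (*s) (mult_3C2 \<alpha>) \<and> \<alpha> \<noteq> 1/2 \<and> \<alpha> + \<beta> = 1) \<or>
    ((\<alpha>, \<beta>) = (1/3, 2/3) \<and>
      (CHAR('f) \<noteq> 5 \<longrightarrow> algebra_iso sc mult (*s) (mult_Q2 :: 'f ^ idxQ2 \<Rightarrow> _)) \<and>
      (CHAR('f) = 5 \<longrightarrow> algebra_iso sc mult (*s) (mult_Q2x :: 'f ^ idxQ2x \<Rightarrow> _)))"
proof -
  interpret a: monster_axis_algebra sc mult \<alpha> \<beta> a
    using assms two_neq_zero_of_CHAR by unfold_locales auto
  interpret b: monster_axis_algebra sc mult \<alpha> \<beta> b
    using assms two_neq_zero_of_CHAR by unfold_locales auto
  \<comment> \<open>The involution of \<open>b\<close> fixes both generators, and its even part is a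
    subalgebra, so it is everything. Hence \<open>a\<close> and \<open>e\<close> decompose with
    respect to \<open>b\<close> without a \<beta>-part.\<close>
  have "{a, b} \<subseteq> b.Even" using fixed b.miyamoto_fixed by blast
  then have "subalgebra hull {a, b} \<subseteq> b.Even" using b.subalgebra_Even by (rule hull_minimal)
  then have all_even: "x \<in> b.Even" for x using generates by blast
  obtain y z where b: "b = y + z" "y \<in> a.Even" "z \<in> a.Odd" by (rule a.parity_decomp)
  have "z \<noteq> 0" using moves a.miyamoto_eq[OF b(2,3)] b(1) by auto
  have "sc 2 y \<in> a.Even" "sc 2 z \<in> a.Odd"
    using b subspace_scale[OF subspace_eigensum] subspace_scale[OF subspace_eigenspace] by blast+
  have "sc 2 b = sc 2 y + sc 2 z" by (simp only: b(1) scale_right_distrib)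
  have "sc 2 z \<noteq> 0" using \<open>z \<noteq> 0\<close> a.two by simp
  obtain \<nu> p0 p1 where p: "sc 2 y = sc \<nu> a + p0 + p1" "p0 \<in> eigenspace a 0" "p1 \<in> eigenspace a \<alpha>"
    using \<open>sc 2 y \<in> a.Even\<close> by (rule a.even_decomp)
  obtain \<mu> a0 a1 where a: "a = sc \<mu> b + a0 + a1" "a0 \<in> eigenspace b 0" "a1 \<in> eigenspace b \<alpha>"
    using all_even by (rule b.even_decomp)
  obtain \<psi> e0 e1 where e: "sc 2 z = sc \<psi> b + e0 + e1" "e0 \<in> eigenspace b 0" "e1 \<in> eigenspace b \<alpha>"
    using all_even by (rule b.even_decomp)
  interpret skew_pair sc mult \<alpha> \<beta> a b "sc 2 y" p0 p1 a0 a1 "sc 2 z" e0 e1 \<nu> \<mu> \<psi>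
    by (unfold_locales; fact)
  show ?thesis by (rule classification)
qed

end

theorem theorem1p1:
  fixes sc :: "'f::field \<Rightarrow> 'a::ab_group_add \<Rightarrow> 'a"
    and mult :: "'a \<Rightarrow> 'a \<Rightarrow> 'a"
    and X :: "'a set"
    and \<alpha> \<beta> :: 'f
  assumes "CHAR('f) \<noteq> 2"
    and "\<alpha> \<notin> {0, 1}" and "\<beta> \<notin> {0, 1}" and "\<alpha> \<noteq> \<beta>"
    and "comm_algebra sc mult"
    and "comm_algebra.primitive_axial_algebra sc mult
           (monster_set \<alpha> \<beta>) (monster_star \<alpha> \<beta>) X"
    and "card X = 2"
    and "comm_algebra.axet_X1p2 sc mult \<alpha> \<beta> (comm_algebra.axis_closure sc mult \<alpha> \<beta> X)"
  shows
    "(algebra_iso sc mult (*s) (mult_3C2 \<alpha>) \<and> \<alpha> \<noteq> 1/2 \<and> \<alpha> + \<beta> = 1) \<or>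
     ((\<alpha>, \<beta>) = (1/3, 2/3) \<and>
       (CHAR('f) \<noteq> 5 \<longrightarrow> algebra_iso sc mult (*s) mult_Q2) \<and>
       (CHAR('f) = 5 \<longrightarrow> algebra_iso sc mult (*s) mult_Q2x))"
proof -
  interpret comm_algebra sc mult by fact
  define Y where "Y = axis_closure \<alpha> \<beta> X"
  obtain a b c where d: "distinct [a, b, c]" and Y: "Y = {a, b, c}"
    and a: "miyamoto \<alpha> \<beta> a b = c" "miyamoto \<alpha> \<beta> a c = b"
    and bc: "\<forall>y\<in>{a, b, c}. miyamoto \<alpha> \<beta> b y = y \<and> miyamoto \<alpha> \<beta> c y = y"
    using assms(8) unfolding axet_X1p2_def Y_def[symmetric] by metis
  have abc: "a \<noteq> b" "a \<noteq> c" "b \<noteq> c" using d by auto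
  have axes: "monster_axis \<alpha> \<beta> x" if "x \<in> X" for x
    using assms(6) that by (simp add: primitive_axial_algebra_def)
  have generates: "subalgebra hull X = UNIV"
    using assms(6) by (simp add: primitive_axial_algebra_def)
  have "X \<subseteq> Y" unfolding Y_def axis_closure_def by (rule hull_subset)
  \<comment> \<open>The involutions of \<open>b\<close> and \<open>c\<close> fix both elements, so
    \<open>{b, c}\<close> would already be closed and the closure could not contain
    \<open>a\<close>.\<close>
  moreover have "X \<noteq> {b, c}"
  proof
    assume X: "X = {b, c}"
    have "Y \<subseteq> {b, c}" unfolding Y_def axis_closure_def X
    proof (rule hull_minimal)
      have "miyamoto \<alpha> \<beta> x ` {b, c} \<subseteq> {b, c}" if "x \<in> {b, c}" for x
        using bc that by blast
      then show "(\<forall>x\<in>{b, c}. monster_axis \<alpha> \<beta> x) \<and>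
          (\<forall>x\<in>{b, c}. miyamoto \<alpha> \<beta> x ` {b, c} \<subseteq> {b, c})"
        using axes X by blast
    qed simp
    then show False using abc Y by blast
  qed
  moreover obtain u v where "X = {u, v}" "u \<noteq> v" using assms(7) by (meson card_2_iff)
  ultimately have "X = {a, b} \<or> X = {a, c}" using Y by blast
  then show ?thesis
  proof
    assume X: "X = {a, b}"
    show ?thesis
    proof (rule classification_of_axis_pair[OF assms(1-4)])
      show "monster_axis \<alpha> \<beta> a" "monster_axis \<alpha> \<beta> b" using axes X by simp_all
      show "subalgebra hull {a, b} = UNIV" using generates X by simp
      show "miyamoto \<alpha> \<beta> a b \<noteq> b" using a(1) abc(3) by metis
      show "miyamoto \<alpha> \<beta> b a = a" "miyamoto \<alpha> \<beta> b b = b" using bc by blast+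
    qed
  next
    assume X: "X = {a, c}"
    show ?thesis
    proof (rule classification_of_axis_pair[OF assms(1-4)])
      show "monster_axis \<alpha> \<beta> a" "monster_axis \<alpha> \<beta> c" using axes X by simp_all
      show "subalgebra hull {a, c} = UNIV" using generates X by simp
      show "miyamoto \<alpha> \<beta> a c \<noteq> c" using a(2) abc(3) by metis
      show "miyamoto \<alpha> \<beta> c a = a" "miyamoto \<alpha> \<beta> c c = c" using bc by blast+
    qed
  qed
qed

end
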